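(* The following two systems are equivalent through explicit transformations. System 1. The pair $(f,h)$ solves, on $\Omega$, $$f_{zz}f_{\bar z}^2+f_{\bar z\bar z}f_z^2-f_{z\bar z}(1+2f_zf_{\bar z})=0,\qquad \frac{f_{z\bar z}}{f_zf_{\bar z}}=h(f),$$ where $f:\Omega\to\mathbb{R}$ is a minimal graph surface with $f_z,f_{\bar z}\neq 0$, and $h:I\to\mathbb{R}$ (the first characteristic function) is non-vanishing and sign-definite on $I=\operatorname{Range}(f)$. System 2. The pair $(u,j)$ solves, on $\Omega$, $$u_{z\bar z}=0,\qquad \frac{u_z^2u_{\bar z\bar z}+u_{\bar z}^2u_{zz}}{u_zu_{\bar z}}=j(u),$$ where $u:\Omega\to\mathbb{R}$ is harmonic with $u_z,u_{\bar z}\neq0$, and $j:J\to\mathbb{R}$ (the second characteristic function) is non-vanishing and sign-definite on $J=u(\Omega)$. The equivalence is established as follows. (Forward direction, 1 $\Rightarrow$ 2.) Given $(f,h)$, define $$H(t)=\int e^{-\int h},\quad K=H^{-1},\quad u=H\circ f,\quad j(s)=\frac{h(K(s))}{K'(s)}.$$ Then $(u,j)$ solves System 2, with $j$ having the same sign as $h$. (Converse direction, 2 $\Rightarrow$ 1.) Given $(u,j)$, construct $h$ as follows. Choose constants $C_1,C_2\in\mathbb{R}$ and a subinterval $J_0\subseteq J$ such that the following construction is valid: $$j_1(s)=-2\int j(s)\,ds+C_1,\quad j_2(s)=\int\frac{1}{\sqrt{j_1(s)}}\,ds\ \text{ (on } J_0\text{, where } j_1(s)>0),\quad j_3=j_2^{-1},$$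 $$H(s)=j_3(s+C_2),\quad h(s)=-\frac{H''(s)}{H'(s)},$$ where $j_2,j_3,H$ are diffeomorphisms. Then, for $f=K(u)$ (on $u^{-1}(J_0)$) with $K=H^{-1}$, and with the domain of definition of $h$ being $I_1=j_2(J_0)-C_2$, the pair $(f,h)$ solves System 1, with $h$ having the same sign as $j$ on the domain. Moreover, the constants $C_1,C_2$ can be chosen so that the solution $(f,h)$ of System 1 corresponds to a solution $(u_0,j_0)$ of System 2 that is defined on a subinterval $J_0\subseteq J$ of desirable size, centered around any desired point $s_0\in J$, and this correspondence is unique up to this choice of constants determining the domain of definition.
   Context: $\Omega\subseteq\mathbb{R}^2\cong\mathbb{C}$ is an open connected set, $z=x+iy$, $\partial_z=\frac12(\partial_x-i\partial_y)$, $\partial_{\bar z}=\frac12(\partial_x+i\partial_y)$; subscripts denote these derivatives. All functions are smooth and $I,J$ are intervals. A minimal graph surface is a smooth $f:\Omega\to\mathbb{R}$ satisfying $(1+f_y^2)f_{xx}-2f_{xy}f_xf_y+(1+f_x^2)f_{yy}=0$; the first equation of System 1 is this equation in complex coordinates, and the second says $\Delta f/\|\nabla f\|^2=h(f)$. "Sign-definite" means entirely positive or entirely negative. An integral sign without limits denotes an antiderivative; $H=\int e^{-\int h}$ means that $H_1$ is an antiderivative of $h$ and $H$ is an antiderivative of $e^{-H_1}$, so $H'>0$ and $H$ is a diffeomorphism onto its image. In the "Moreover" part, $u_0$ and $j_0$ are the restrictions of $u$ and $j$ to $u^{-1}(J_0)$ and $J_0$. *)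

theory Defs
  imports "HOL-Analysis.Analysis"
begin

text \<open>
  Functions on a subset of the plane or of the line are total functions of which only the values on
  that subset matter. The plane is the type \<^typ>\<open>complex\<close>. Smoothness below is meant for open sets:
  all iterated directional derivatives exist and are continuous.
\<close>

fun Ck_on :: "nat \<Rightarrow> 'a::real_normed_vector set \<Rightarrow> ('a \<Rightarrow> 'b::real_normed_vector) \<Rightarrow> bool" where
  "Ck_on 0 S g \<longleftrightarrow> continuous_on S g"
| "Ck_on (Suc k) S g \<longleftrightarrow>
     (\<forall>x\<in>S. g differentiable (at x)) \<and> (\<forall>v. Ck_on k S (\<lambda>x. frechet_derivative g (at x) v))"

definition smooth_on :: "'a::real_normed_vector set \<Rightarrow> ('a \<Rightarrow> 'b::real_normed_vector) \<Rightarrow> bool" where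
  "smooth_on S g \<longleftrightarrow> (\<forall>k. Ck_on k S g)"

definition diffeo :: "real set \<Rightarrow> real set \<Rightarrow> (real \<Rightarrow> real) \<Rightarrow> bool" where
  "diffeo S T g \<longleftrightarrow> bij_betw g S T \<and> smooth_on S g \<and> smooth_on T (inv_into S g)"

definition sign_definite_on :: "real set \<Rightarrow> (real \<Rightarrow> real) \<Rightarrow> bool" where
  "sign_definite_on S g \<longleftrightarrow> (\<forall>t\<in>S. g t > 0) \<or> (\<forall>t\<in>S. g t < 0)"

definition antiderivative_on :: "real set \<Rightarrow> (real \<Rightarrow> real) \<Rightarrow> (real \<Rightarrow> real) \<Rightarrow> bool" where
  "antiderivative_on S g G \<longleftrightarrow> (\<forall>x\<in>S. (G has_real_derivative g x) (at x))"

definition dx :: "(complex \<Rightarrow> 'b::real_normed_vector) \<Rightarrow> complex \<Rightarrow> 'b" where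
  "dx F z = frechet_derivative F (at z) 1"

definition dy :: "(complex \<Rightarrow> 'b::real_normed_vector) \<Rightarrow> complex \<Rightarrow> 'b" where
  "dy F z = frechet_derivative F (at z) \<i>"

definition dz :: "(complex \<Rightarrow> complex) \<Rightarrow> complex \<Rightarrow> complex" where
  "dz F z = (dx F z - \<i> * dy F z) / 2"

definition dzbar :: "(complex \<Rightarrow> complex) \<Rightarrow> complex \<Rightarrow> complex" where
  "dzbar F z = (dx F z + \<i> * dy F z) / 2"

definition cplx :: "(complex \<Rightarrow> real) \<Rightarrow> complex \<Rightarrow> complex" where
  "cplx f z = complex_of_real (f z)"

definition minimal_graph_on :: "complex set \<Rightarrow> (complex \<Rightarrow> real) \<Rightarrow> bool" where
  "minimal_graph_on D f \<longleftrightarrow> smooth_on D f \<and>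
     (\<forall>z\<in>D. (1 + (dy f z)\<^sup>2) * dx (dx f) z - 2 * dy (dx f) z * dx f z * dy f z
            + (1 + (dx f z)\<^sup>2) * dy (dy f) z = 0)"

definition harmonic_on :: "complex set \<Rightarrow> (complex \<Rightarrow> real) \<Rightarrow> bool" where
  "harmonic_on D u \<longleftrightarrow> smooth_on D u \<and> (\<forall>z\<in>D. dx (dx u) z + dy (dy u) z = 0)"

text \<open>
  Connectedness of the domain is not part of the two systems, because they are also considered on
  the open sets \<open>u\<^sup>-\<^sup>1(J\<^sub>0)\<close>, which need not be connected. It is a hypothesis on the original
  domain in the theorem.
\<close>

definition system1 :: "complex set \<Rightarrow> real set \<Rightarrow> (complex \<Rightarrow> real) \<Rightarrow> (real \<Rightarrow> real) \<Rightarrow> bool" where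
  "system1 D I f h \<longleftrightarrow>
     open D \<and> minimal_graph_on D f \<and> I = f ` D \<and> is_interval I \<and>
     smooth_on I h \<and> (\<forall>t\<in>I. h t \<noteq> 0) \<and> sign_definite_on I h \<and>
     (\<forall>z\<in>D. dz (cplx f) z \<noteq> 0 \<and> dzbar (cplx f) z \<noteq> 0 \<and>
        dz (dz (cplx f)) z * (dzbar (cplx f) z)\<^sup>2 + dzbar (dzbar (cplx f)) z * (dz (cplx f) z)\<^sup>2
          - dzbar (dz (cplx f)) z * (1 + 2 * dz (cplx f) z * dzbar (cplx f) z) = 0 \<and>
        dzbar (dz (cplx f)) z / (dz (cplx f) z * dzbar (cplx f) z) = complex_of_real (h (f z)))"

definition system2 :: "complex set \<Rightarrow> real set \<Rightarrow> (complex \<Rightarrow> real) \<Rightarrow> (real \<Rightarrow> real) \<Rightarrow> bool" where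
  "system2 D J u j \<longleftrightarrow>
     open D \<and> harmonic_on D u \<and> J = u ` D \<and> is_interval J \<and>
     smooth_on J j \<and> (\<forall>s\<in>J. j s \<noteq> 0) \<and> sign_definite_on J j \<and>
     (\<forall>z\<in>D. dz (cplx u) z \<noteq> 0 \<and> dzbar (cplx u) z \<noteq> 0 \<and>
        dzbar (dz (cplx u)) z = 0 \<and>
        ((dz (cplx u) z)\<^sup>2 * dzbar (dzbar (cplx u)) z + (dzbar (cplx u) z)\<^sup>2 * dz (dz (cplx u)) z)
          / (dz (cplx u) z * dzbar (cplx u) z) = complex_of_real (j (u z)))"

text \<open>
  Forward transformation. \<open>forward_H I h H\<close> says that \<open>H\<close> is one of the functions
  \<open>\<integral> exp (- \<integral> h)\<close> on \<open>I\<close>; it is a relation, since both antiderivatives may be chosen freely.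
\<close>

definition forward_H :: "real set \<Rightarrow> (real \<Rightarrow> real) \<Rightarrow> (real \<Rightarrow> real) \<Rightarrow> bool" where
  "forward_H I h H \<longleftrightarrow>
     (\<exists>H1. antiderivative_on I h H1 \<and> antiderivative_on I (\<lambda>t. exp (- H1 t)) H)"

definition forward_j :: "real set \<Rightarrow> (real \<Rightarrow> real) \<Rightarrow> (real \<Rightarrow> real) \<Rightarrow> real \<Rightarrow> real" where
  "forward_j I h H s = (let K = inv_into I H in h (K s) / deriv K s)"

definition corresponds_via ::
  "(real \<Rightarrow> real) \<Rightarrow> complex set \<Rightarrow> real set \<Rightarrow> (complex \<Rightarrow> real) \<Rightarrow> (real \<Rightarrow> real)
     \<Rightarrow> real set \<Rightarrow> (complex \<Rightarrow> real) \<Rightarrow> (real \<Rightarrow> real) \<Rightarrow> bool" where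
  "corresponds_via H D I f h J u j \<longleftrightarrow>
     forward_H I h H \<and> J = H ` I \<and>
     (\<forall>z\<in>D. u z = H (f z)) \<and> (\<forall>s\<in>J. j s = forward_j I h H s)"

text \<open>
  Converse transformation. Here \<open>A\<close> is an antiderivative of \<open>j\<close> and \<open>j2\<close> one of \<open>1 / sqrt j\<^sub>1\<close>;
  the functions \<open>H\<close>, \<open>h\<close>, \<open>f\<close> and the interval \<open>I\<^sub>1\<close> are then determined by \<open>J0\<close>, \<open>j2\<close> and \<open>C2\<close>.
\<close>

definition conv_j1 :: "(real \<Rightarrow> real) \<Rightarrow> real \<Rightarrow> real \<Rightarrow> real" where
  "conv_j1 A C1 s = - 2 * A s + C1"

definition admissible ::
  "real set \<Rightarrow> (real \<Rightarrow> real) \<Rightarrow> (real \<Rightarrow> real) \<Rightarrow> real \<Rightarrow> real set \<Rightarrow> bool" where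
  "admissible J j A C1 J0 \<longleftrightarrow>
     antiderivative_on J j A \<and>
     open J0 \<and> is_interval J0 \<and> J0 \<noteq> {} \<and> J0 \<subseteq> J \<and> (\<forall>s\<in>J0. conv_j1 A C1 s > 0)"

definition conv_j2 :: "(real \<Rightarrow> real) \<Rightarrow> real \<Rightarrow> real set \<Rightarrow> (real \<Rightarrow> real) \<Rightarrow> bool" where
  "conv_j2 A C1 J0 j2 \<longleftrightarrow> antiderivative_on J0 (\<lambda>s. 1 / sqrt (conv_j1 A C1 s)) j2"

definition conv_j3 :: "real set \<Rightarrow> (real \<Rightarrow> real) \<Rightarrow> real \<Rightarrow> real" where
  "conv_j3 J0 j2 = inv_into J0 j2"

definition conv_I :: "real set \<Rightarrow> (real \<Rightarrow> real) \<Rightarrow> real \<Rightarrow> real set" where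
  "conv_I J0 j2 C2 = (\<lambda>s. j2 s - C2) ` J0"

definition conv_H :: "real set \<Rightarrow> (real \<Rightarrow> real) \<Rightarrow> real \<Rightarrow> real \<Rightarrow> real" where
  "conv_H J0 j2 C2 s = conv_j3 J0 j2 (s + C2)"

definition conv_h :: "real set \<Rightarrow> (real \<Rightarrow> real) \<Rightarrow> real \<Rightarrow> real \<Rightarrow> real" where
  "conv_h J0 j2 C2 s = - deriv (deriv (conv_H J0 j2 C2)) s / deriv (conv_H J0 j2 C2) s"

definition conv_f ::
  "real set \<Rightarrow> (real \<Rightarrow> real) \<Rightarrow> real \<Rightarrow> (complex \<Rightarrow> real) \<Rightarrow> complex \<Rightarrow> real" where
  "conv_f J0 j2 C2 u z = inv_into (conv_I J0 j2 C2) (conv_H J0 j2 C2) (u z)"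

definition sub_domain :: "complex set \<Rightarrow> (complex \<Rightarrow> real) \<Rightarrow> real set \<Rightarrow> complex set" where
  "sub_domain \<Omega> u J0 = {z \<in> \<Omega>. u z \<in> J0}"

end

theory Submission
  imports Defs "HOL-Complex_Analysis.Complex_Analysis"
begin

text \<open>
  For \<open>u = H(f)\<close> with \<open>H'' = - h H'\<close> the chain rule turns the two equations for \<open>f\<close> into the two
  equations for \<open>u\<close> with \<open>j(H) = h H'\<close>. Conversely \<open>H'' = - j(H)\<close> has the first integral
  \<open>H'\<^sup>2 + 2 A(H) = C\<^sub>1\<close>, where \<open>A' = j\<close>, and is solved by quadrature; \<open>C\<^sub>1\<close> and the translation
  \<open>C\<^sub>2\<close> are determined by \<open>H\<close>, which is the uniqueness. That \<open>C\<^sub>1\<close> can be chosen for every bounded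
  interval requires \<open>A\<close> to be bounded below there, also when the interval reaches an end point of
  \<open>J\<close>. This holds because System 2 forces \<open>j'' = c j\<close> for a constant \<open>c\<close>, so \<open>j\<close> is bounded.
\<close>
section \<open>Smooth functions\<close>

text \<open>Put T(f) = f_y^2 f_xx - 2 f_x f_y f_xy + f_x^2 f_yy. It measures the bending of the
  level lines of f, so relabelling the levels only rescales it: T(H(f)) = H'(f)^3 T(f). The minimal
  surface equation is Laplace f + T(f) = 0, and for harmonic u the second equation of System 2 reads
  T(u) = - j(u) |grad u|^2. With Laplace f = h(f) |grad f|^2 this gives T(u) = - h(f) H'(f) |grad
  u|^2, which is where j(H) = h H' comes from; the choice H'' = - h H' is what makes u harmonic.

  The first integral is the energy of a particle with potential A: multiply H'' = - j(H) by 2 H' and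
  integrate. The obstacle is the boundary of J: an arbitrary smooth j on an open interval may grow
  so fast at an end point that A is not bounded above there, and then no \<open>C1\<close> would
  serve an interval reaching that end. Connectedness of the domain enters exactly here, because it
  makes c one constant for all of J.\<close>

lemma Ck_on_cong:
  fixes f g :: "'a::real_normed_vector \<Rightarrow> 'b::real_normed_vector"
  assumes "open S" "\<And>x. x \<in> S \<Longrightarrow> f x = g x"
  shows "Ck_on k S f \<longleftrightarrow> Ck_on k S g"
  using assms(2)
proof (induction k arbitrary: f g)
  case 0
  then show ?case by (simp cong: continuous_on_cong)
next
  case (Suc k)
  \<comment> \<open>The situation is symmetric, so one implication is enough. As \<open>S\<close> is
    open, the derivative at a point of \<open>S\<close> depends only on values in \<open>S\<close>,
    and equality passes to all derivatives.\<close>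
  have imp: "Ck_on (Suc k) S q" if "Ck_on (Suc k) S p" and eq: "\<And>x. x \<in> S \<Longrightarrow> p x = q x" for p q :: "'a \<Rightarrow> 'b"
  proof -
    have d: "(q has_derivative frechet_derivative p (at x)) (at x)" if "x \<in> S" for x
      using that \<open>Ck_on (Suc k) S p\<close> assms(1) eq
      by (auto intro: has_derivative_transform_within_open simp: frechet_derivative_works)
    then have "frechet_derivative p (at x) = frechet_derivative q (at x)" if "x \<in> S" for x
      using that frechet_derivative_at by blast
    then have "Ck_on k S (\<lambda>x. frechet_derivative q (at x) v)" for v
      using Suc.IH[of "\<lambda>x. frechet_derivative p (at x) v" "\<lambda>x. frechet_derivative q (at x) v"]
        \<open>Ck_on (Suc k) S p\<close> by simp
    then show ?thesis using d by (auto simp: differentiable_def)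
  qed
  show ?case
    using imp[of f g] imp[of g f] Suc.prems by (auto simp del: Ck_on.simps)
qed

text \<open>Allows any explicitly computed derivative in place of
  \<open>frechet_derivative\<close>.\<close>

lemma Ck_on_SucI:
  assumes "open S" "\<And>x. x \<in> S \<Longrightarrow> (g has_derivative g' x) (at x)" "\<And>v. Ck_on k S (\<lambda>x. g' x v)"
  shows "Ck_on (Suc k) S g"
proof -
  have "frechet_derivative g (at x) = g' x" if "x \<in> S" for x
    using assms(2)[OF that] frechet_derivative_at by metis
  then have "Ck_on k S (\<lambda>x. frechet_derivative g (at x) v)" for v
    using assms(3)[of v]
      Ck_on_cong[OF assms(1), of "\<lambda>x. frechet_derivative g (at x) v" "\<lambda>x. g' x v" k]
    by simp
  then show ?thesis using assms(2) by (auto simp: differentiable_def)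
qed

lemma Ck_on_differentiable:
  "Ck_on (Suc k) S g \<Longrightarrow> x \<in> S \<Longrightarrow> (g has_derivative frechet_derivative g (at x)) (at x)"
  by (simp add: frechet_derivative_works)

lemma Ck_on_SucD: "Ck_on (Suc k) S g \<Longrightarrow> Ck_on k S g"
proof (induction k arbitrary: g)
  case 0
  then show ?case
    by (auto intro!: continuous_at_imp_continuous_on differentiable_imp_continuous_within)
next
  case (Suc k)
  then show ?case by simp
qed

lemma Ck_on_subset: "Ck_on k S g \<Longrightarrow> T \<subseteq> S \<Longrightarrow> Ck_on k T g"
  by (induction k arbitrary: g) (auto intro: continuous_on_subset)

lemma Ck_on_const: "Ck_on k S (\<lambda>x. c)"
proof (induction k arbitrary: c)
  case (Suc k)
  then show ?case by (simp add: frechet_derivative_const)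
qed simp

lemma Ck_on_add:
  assumes "open S" "Ck_on k S f" "Ck_on k S g"
  shows "Ck_on k S (\<lambda>x. f x + g x)"
  using assms(2,3)
proof (induction k arbitrary: f g)
  case 0
  then show ?case by (simp add: continuous_on_add)
next
  case (Suc k)
  show ?case
  proof (rule Ck_on_SucI[OF assms(1)])
    show "((\<lambda>x. f x + g x) has_derivative
        (\<lambda>v. frechet_derivative f (at x) v + frechet_derivative g (at x) v)) (at x)" if "x \<in> S" for x
      using Suc.prems that by (intro has_derivative_add Ck_on_differentiable)
    show "Ck_on k S (\<lambda>x. frechet_derivative f (at x) v + frechet_derivative g (at x) v)" for v
      using Suc by simp
  qed
qed

lemma Ck_on_mult:
  fixes f g :: "'a::real_normed_vector \<Rightarrow> real"
  assumes "open S" "Ck_on k S f" "Ck_on k S g"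
  shows "Ck_on k S (\<lambda>x. f x * g x)"
  using assms(2,3)
proof (induction k arbitrary: f g)
  case 0
  then show ?case using continuous_on_mult[of S f g] by simp
next
  case (Suc k)
  show ?case
  proof (rule Ck_on_SucI[OF assms(1)])
    show "((\<lambda>x. f x * g x) has_derivative
        (\<lambda>v. f x * frechet_derivative g (at x) v + frechet_derivative f (at x) v * g x)) (at x)"
      if "x \<in> S" for x
      by (rule has_derivative_mult[OF Ck_on_differentiable[OF Suc.prems(1) that]
            Ck_on_differentiable[OF Suc.prems(2) that]])
    show "Ck_on k S (\<lambda>x. f x * frechet_derivative g (at x) v + frechet_derivative f (at x) v * g x)" for v
      by (rule Ck_on_add[OF assms(1) Suc.IH Suc.IH])
        (use Suc.prems in \<open>simp_all add: Ck_on_SucD del: Ck_on.simps(2)\<close>,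
         use Suc.prems in simp_all)
  qed
qed

text \<open>On the line every directional derivative is a constant multiple of g', so the quantifier
  over directions disappears.\<close>

lemma Ck_on_Suc_real:
  fixes g :: "real \<Rightarrow> real"
  assumes "open S" "\<And>x. x \<in> S \<Longrightarrow> (g has_real_derivative g' x) (at x)"
  shows "Ck_on (Suc k) S g \<longleftrightarrow> Ck_on k S g'"
proof
  have fr: "frechet_derivative g (at x) v = g' x * v" if "x \<in> S" for x v
    using assms(2)[OF that] frechet_derivative_at unfolding has_field_derivative_def by metis
  assume "Ck_on (Suc k) S g"
  then have "Ck_on k S (\<lambda>x. frechet_derivative g (at x) 1)" by simp
  then show "Ck_on k S g'"
    by (subst Ck_on_cong[OF assms(1), where g = "\<lambda>x. frechet_derivative g (at x) 1"]) (auto simp: fr)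
next
  assume "Ck_on k S g'"
  then show "Ck_on (Suc k) S g"
    using assms
    by (intro Ck_on_SucI[where g' = "\<lambda>x v. g' x * v"] Ck_on_mult Ck_on_const)
       (auto simp: has_field_derivative_def)
qed

lemma smooth_on_real_iff:
  fixes g :: "real \<Rightarrow> real"
  assumes "open S" "\<And>x. x \<in> S \<Longrightarrow> (g has_real_derivative g' x) (at x)"
  shows "smooth_on S g \<longleftrightarrow> smooth_on S g'"
  using Ck_on_Suc_real[OF assms] Ck_on_SucD unfolding smooth_on_def by metis

lemma Ck_on_real_deriv:
  fixes g :: "real \<Rightarrow> real"
  assumes "Ck_on (Suc k) S g" "x \<in> S"
  shows "(g has_real_derivative deriv g x) (at x)"
  using assms
  by (metis Ck_on.simps(2) DERIV_deriv_iff_real_differentiable)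

text \<open>By the chain rule each derivative is a product with factor g'(f). The induction
  therefore varies \<open>g\<close> and is applied to \<open>deriv g\<close>, with \<open>f\<close>
  lowered by one order.\<close>

lemma Ck_on_compose:
  fixes f :: "'a::real_normed_vector \<Rightarrow> real" and g :: "real \<Rightarrow> real"
  assumes "open S" "open T" "Ck_on k S f" "Ck_on k T g" "f ` S \<subseteq> T"
  shows "Ck_on k S (\<lambda>x. g (f x))"
  using assms(3,4)
proof (induction k arbitrary: g)
  case 0
  then show ?case using assms(5) continuous_on_compose2 by auto
next
  case (Suc k)
  have d: "(g has_real_derivative deriv g y) (at y)" if "y \<in> T" for y
    using Ck_on_real_deriv Suc.prems(2) that by blast
  then have g': "Ck_on k T (deriv g)"
    using Ck_on_Suc_real[OF assms(2)] Suc.prems(2) by blast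
  show ?case
  proof (rule Ck_on_SucI[OF assms(1)])
    show "((\<lambda>x. g (f x)) has_derivative (\<lambda>v. deriv g (f x) * frechet_derivative f (at x) v)) (at x)"
      if "x \<in> S" for x
    proof -
      have "f x \<in> T" using that assms(5) by auto
      then have "(g has_derivative (*) (deriv g (f x))) (at (f x))"
        using d unfolding has_field_derivative_def by blast
      then show ?thesis
        using Ck_on_differentiable[OF Suc.prems(1) that] has_derivative_compose by blast
    qed
    show "Ck_on k S (\<lambda>x. deriv g (f x) * frechet_derivative f (at x) v)" for v
      using Suc.IH[OF Ck_on_SucD[OF Suc.prems(1)] g'] Suc.prems(1)
      by (intro Ck_on_mult assms(1)) simp_all
  qed
qed

lemma smooth_on_compose:
  fixes f :: "'a::real_normed_vector \<Rightarrow> real" and g :: "real \<Rightarrow> real"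
  assumes "open S" "open T" "smooth_on S f" "smooth_on T g" "f ` S \<subseteq> T"
  shows "smooth_on S (\<lambda>x. g (f x))"
  using assms Ck_on_compose unfolding smooth_on_def by blast

lemma smooth_on_mult:
  fixes f g :: "'a::real_normed_vector \<Rightarrow> real"
  assumes "open S" "smooth_on S f" "smooth_on S g"
  shows "smooth_on S (\<lambda>x. f x * g x)"
  using assms Ck_on_mult unfolding smooth_on_def by blast

lemma smooth_on_cong:
  assumes "open S" "\<And>x. x \<in> S \<Longrightarrow> f x = g x"
  shows "smooth_on S f \<longleftrightarrow> smooth_on S g"
proof -
  have "Ck_on k S f \<longleftrightarrow> Ck_on k S g" for k
    by (rule Ck_on_cong[OF assms])
  then show ?thesis by (simp add: smooth_on_def)
qed

lemma smooth_on_subset: "smooth_on S g \<Longrightarrow> T \<subseteq> S \<Longrightarrow> smooth_on T g"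
  using Ck_on_subset unfolding smooth_on_def by blast

section \<open>Smoothness of the exponential, the reciprocal and the square root\<close>

lemma smooth_on_uminus_exp: "smooth_on UNIV (\<lambda>x::real. exp (- x))"
proof -
  \<comment> \<open>The factor \<open>c\<close> absorbs the sign produced by each
    differentiation.\<close>
  have "Ck_on k UNIV (\<lambda>x::real. c * exp (- x))" for k c
  proof (induction k arbitrary: c)
    case (Suc k)
    have "((\<lambda>x::real. c * exp (- x)) has_real_derivative - c * exp (- x)) (at x)" for x
      by (auto intro!: derivative_eq_intros)
    from Ck_on_Suc_real[OF open_UNIV this] Suc show ?case by blast
  qed (auto intro!: continuous_intros)
  from this[of _ 1] show ?thesis by (simp add: smooth_on_def)
qed

text \<open>The derivative is a polynomial in the function itself, so order k for
  \<open>inverse\<close> yields order k + 1.\<close>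

lemma smooth_on_inverse: "smooth_on (- {0}) (inverse :: real \<Rightarrow> real)"
proof -
  have o: "open (- {0::real})" by auto
  have "Ck_on k (- {0}) (inverse :: real \<Rightarrow> real)" for k
  proof (induction k)
    case 0
    then show ?case by (auto intro!: continuous_intros)
  next
    case (Suc k)
    have "(inverse has_real_derivative - 1 * (inverse x * inverse x)) (at x)" if "x \<in> - {0}" for x :: real
      using that by (auto intro!: derivative_eq_intros)
    from Ck_on_Suc_real[OF o this] show ?case
      using Ck_on_mult[OF o Ck_on_const Ck_on_mult[OF o Suc Suc]] by blast
  qed
  then show ?thesis by (simp add: smooth_on_def)
qed

text \<open>The same bootstrap: the derivative is half the reciprocal of \<open>sqrt\<close>, of
  order k as soon as \<open>sqrt\<close> is.\<close>

lemma smooth_on_sqrt: "smooth_on {0<..} sqrt"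
proof -
  have "Ck_on k {0<..} sqrt" for k
  proof (induction k)
    case 0
    then show ?case by (auto intro!: continuous_intros)
  next
    case (Suc k)
    have d: "(sqrt has_real_derivative inverse (sqrt x) * (1/2)) (at x)" if "x \<in> {0<..}" for x
      using DERIV_real_sqrt that by (simp add: field_simps)
    have "Ck_on k {0<..} (\<lambda>x. inverse (sqrt x))"
      by (rule Ck_on_compose[OF _ _ Suc, where T = "- {0}"])
        (use smooth_on_inverse in \<open>auto simp: smooth_on_def\<close>)
    from Ck_on_mult[OF open_greaterThan this Ck_on_const]
    show ?case
      using Ck_on_Suc_real[OF open_greaterThan d] by blast
  qed
  then show ?thesis by (simp add: smooth_on_def)
qed

section \<open>Increasing diffeomorphisms of intervals\<close>

text \<open>Along a direction of positive derivative the function takes values on both sides of f x.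
  The image, being an interval, then contains everything between them, so no inverse function
  theorem is called for.\<close>

lemma open_image_if_derivative_nonzero:
  fixes f :: "'a::real_normed_vector \<Rightarrow> real"
  assumes "open D" "is_interval (f ` D)"
    and der: "\<And>x. x \<in> D \<Longrightarrow> (f has_derivative f' x) (at x)"
    and nz: "\<And>x. x \<in> D \<Longrightarrow> \<exists>v. f' x v \<noteq> 0"
  shows "open (f ` D)"
proof (rule openI)
  fix y assume "y \<in> f ` D"
  then obtain x where x: "x \<in> D" "y = f x" by auto
  interpret bounded_linear "f' x" using der[OF x(1)] by (rule has_derivative_bounded_linear)
  obtain v0 where "f' x v0 \<noteq> 0" using nz x by auto
  \<comment> \<open>Either \<open>v0\<close> or its negative.\<close>
  then obtain v where v: "f' x v > 0"
    by (metis linorder_neqE_linordered_idom linear_neg linear_axioms neg_0_less_iff_less)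
  have "((\<lambda>t. x + t *\<^sub>R v) has_derivative (\<lambda>t. t *\<^sub>R v)) (at (0::real))"
    by (auto intro!: derivative_eq_intros)
  then have "((\<lambda>t. f (x + t *\<^sub>R v)) has_derivative (\<lambda>t. f' x (t *\<^sub>R v))) (at (0::real))"
    using has_derivative_compose der x(1) by (metis add.right_neutral scaleR_zero_left)
  then have d: "((\<lambda>t. f (x + t *\<^sub>R v)) has_real_derivative f' x v) (at 0)"
    unfolding has_field_derivative_def
    by (rule has_derivative_eq_rhs) (simp add: fun_eq_iff scaleR)
  obtain d1 where d1: "d1 > 0" "\<And>h. 0 < h \<Longrightarrow> h < d1 \<Longrightarrow> f x < f (x + h *\<^sub>R v)"
    using DERIV_pos_inc_right[OF d v] by auto
  obtain d2 where d2: "d2 > 0" "\<And>h. 0 < h \<Longrightarrow> h < d2 \<Longrightarrow> f (x + (-h) *\<^sub>R v) < f x"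
    using DERIV_pos_inc_left[OF d v] by auto
  have "((\<lambda>t. x + t *\<^sub>R v) \<longlongrightarrow> x + 0 *\<^sub>R v) (at (0::real))"
    by (intro tendsto_intros)
  then have "\<forall>\<^sub>F t in at (0::real). x + t *\<^sub>R v \<in> D"
    using topological_tendstoD[of _ _ _ D] assms(1) x(1) by fastforce
  then obtain d3 where d3: "d3 > 0" "\<And>t. t \<noteq> 0 \<Longrightarrow> \<bar>t\<bar> < d3 \<Longrightarrow> x + t *\<^sub>R v \<in> D"
    by (auto simp: eventually_at dist_real_def)
  define h where "h = Min {d1, d2, d3} / 2"
  have h: "0 < h" "h < d1" "h < d2" "h < d3" using d1(1) d2(1) d3(1) by (auto simp: h_def min_def)
  let ?a = "f (x + (-h) *\<^sub>R v)" and ?b = "f (x + h *\<^sub>R v)"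
  have ab: "?a < y" "y < ?b" "?a \<in> f ` D" "?b \<in> f ` D"
    using d1(2) d2(2) d3(2)[of h] d3(2)[of "-h"] h x(2) by auto
  then have "{?a<..<?b} \<subseteq> f ` D"
    using assms(2) unfolding is_interval_1 by (meson greaterThanLessThan_iff less_imp_le subsetI)
  moreover have "ball y (min (y - ?a) (?b - y)) \<subseteq> {?a<..<?b}"
    by (auto simp: dist_real_def abs_less_iff)
  ultimately show "\<exists>e>0. ball y e \<subseteq> f ` D"
    using ab by (intro exI[of _ "min (y - ?a) (?b - y)"]) auto
qed

section \<open>Antiderivatives on open intervals\<close>

lemma antiderivative_on_exists:
  assumes "open S" "is_interval S" "continuous_on S g"
  shows "\<exists>G. antiderivative_on S g G"
proof (cases "S = {}")
  case False
  \<comment> \<open>\<open>S\<close> may be unbounded, so its end points are taken in the extended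
    reals; openness keeps them outside \<open>S\<close>.\<close>
  define a b where "a = Inf (ereal ` S)" and "b = Sup (ereal ` S)"
  have S: "x \<in> S" if "a < ereal x" "ereal x < b" for x
  proof -
    obtain y z where "y \<in> S" "y < x" "z \<in> S" "x < z"
      using \<open>a < ereal x\<close> \<open>ereal x < b\<close> unfolding a_def b_def Inf_less_iff less_Sup_iff by auto
    then show ?thesis using assms(2) unfolding is_interval_1 by (meson less_imp_le)
  qed
  have ab: "a < ereal x \<and> ereal x < b" if "x \<in> S" for x
  proof -
    obtain e where "e > 0" "cball x e \<subseteq> S" using assms(1) \<open>x \<in> S\<close> open_contains_cball by blast
    then have "x - e \<in> S" "x + e \<in> S" by (auto simp: cball_eq_atLeastAtMost)
    moreover have "ereal (x - e) < ereal x" "ereal x < ereal (x + e)" using \<open>e > 0\<close> by auto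
    ultimately show ?thesis unfolding a_def b_def Inf_less_iff less_Sup_iff by blast
  qed
  obtain x0 where "x0 \<in> S" using False by auto
  then have "a < b" using ab less_trans by blast
  moreover have "isCont g x" if "a < ereal x" "ereal x < b" for x
    using S[OF that] assms(1,3) continuous_on_eq_continuous_at by blast
  ultimately obtain F
    where "\<And>x. a < ereal x \<Longrightarrow> ereal x < b \<Longrightarrow> (F has_vector_derivative g x) (at x)"
    using einterval_antiderivative[of a b g] by blast
  then have "antiderivative_on S g F"
    using ab by (simp add: antiderivative_on_def has_real_derivative_iff_has_vector_derivative)
  then show ?thesis by blast
qed (simp add: antiderivative_on_def)

lemma antiderivative_on_smooth:
  assumes "open S" "smooth_on S g" "antiderivative_on S g G"
  shows "smooth_on S G"
  using smooth_on_real_iff[OF assms(1)] assms(2,3) unfolding antiderivative_on_def by blast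

lemma smooth_on_continuous_on: "smooth_on S g \<Longrightarrow> continuous_on S g"
  unfolding smooth_on_def by (metis Ck_on.simps(1))

lemma smooth_on_DERIV:
  fixes g :: "real \<Rightarrow> real"
  shows "smooth_on S g \<Longrightarrow> x \<in> S \<Longrightarrow> (g has_real_derivative deriv g x) (at x)"
  unfolding smooth_on_def using Ck_on_real_deriv by blast

text \<open>One setting for the forward H, for \<open>j2\<close>, for its translates and for the
  converse H. \<open>g'\<close> is a parameter and not \<open>deriv g\<close>, so that every
  instance keeps its explicit formula.\<close>

locale increasing_diffeo =
  fixes S :: "real set" and g g' :: "real \<Rightarrow> real"
  assumes open_S: "open S" and interval_S: "is_interval S"
    and smooth_g': "smooth_on S g'"
    and deriv_g: "x \<in> S \<Longrightarrow> (g has_real_derivative g' x) (at x)"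
    and deriv_pos: "x \<in> S \<Longrightarrow> g' x > 0"
begin

lemma smooth_g: "smooth_on S g"
  using smooth_on_real_iff[OF open_S deriv_g] smooth_g' by blast

lemma less:
  assumes "x \<in> S" "y \<in> S" "x < y"
  shows "g x < g y"
proof (rule DERIV_pos_imp_increasing[OF assms(3)])
  fix t assume "x \<le> t" "t \<le> y"
  then have "t \<in> S" using interval_S assms unfolding is_interval_1 by blast
  then show "\<exists>d. (g has_real_derivative d) (at t) \<and> 0 < d"
    using deriv_g deriv_pos by blast
qed

lemma inj: "inj_on g S"
  by (metis inj_onI less linorder_neqE_linordered_idom order_less_irrefl)

lemma interval_image: "is_interval (g ` S)"
  unfolding is_interval_connected_1
  using interval_S smooth_on_continuous_on[OF smooth_g]
  by (auto intro: connected_continuous_image simp: is_interval_connected_1)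

lemma open_image: "open (g ` S)"
proof (rule open_image_if_derivative_nonzero[OF open_S interval_image])
  show "(g has_derivative (*) (g' x)) (at x)" if "x \<in> S" for x
    using deriv_g[OF that] by (simp add: has_field_derivative_def)
  show "\<exists>v. g' x * v \<noteq> 0" if "x \<in> S" for x
    using deriv_pos[OF that] by (intro exI[of _ 1]) simp
qed

lemma deriv_inv:
  assumes "x \<in> S"
  shows "(inv_into S g has_real_derivative inverse (g' x)) (at (g x))"
proof (rule has_field_derivative_inverse_strong[OF deriv_g[OF assms] _ open_S assms])
  show "g' x \<noteq> 0" using deriv_pos[OF assms] by simp
qed (use inj smooth_g in \<open>auto intro: smooth_on_continuous_on\<close>)

lemma deriv_inv':
  assumes "y \<in> g ` S"
  shows "(inv_into S g has_real_derivative inverse (g' (inv_into S g y))) (at y)"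
  using deriv_inv[OF inv_into_into[OF assms]] f_inv_into_f[OF assms] by simp

text \<open>A bootstrap: the derivative of the inverse is the reciprocal of g' evaluated at the
  inverse, so each order of smoothness of the inverse gives the next one.\<close>

lemma smooth_deriv_inv: "smooth_on (g ` S) (\<lambda>y. inverse (g' (inv_into S g y)))"
proof -
  have im: "inv_into S g ` (g ` S) \<subseteq> S" by (auto intro: inv_into_into)
  have o: "open (- {0::real})" by auto
  have "Ck_on k (g ` S) (inv_into S g)" for k
  proof (induction k)
    case 0
    have "isCont (inv_into S g) y" if "y \<in> g ` S" for y
      using DERIV_isCont[OF deriv_inv'[OF that]] .
    then show ?case by (simp add: continuous_at_imp_continuous_on)
  next
    case (Suc k)
    have "Ck_on k (g ` S) (\<lambda>y. g' (inv_into S g y))"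
      using smooth_g' Ck_on_compose[OF open_image open_S Suc _ im] unfolding smooth_on_def by blast
    then have "Ck_on k (g ` S) (\<lambda>y. inverse (g' (inv_into S g y)))"
      by (rule Ck_on_compose[OF open_image o])
        (use smooth_on_inverse im deriv_pos in \<open>force simp: smooth_on_def\<close>)+
    then show ?case using Ck_on_Suc_real[OF open_image deriv_inv'] by blast
  qed
  then have "smooth_on (g ` S) (inv_into S g)" by (simp add: smooth_on_def)
  then show ?thesis
    using smooth_on_real_iff[OF open_image deriv_inv'] by blast
qed

lemma smooth_inv: "smooth_on (g ` S) (inv_into S g)"
  using smooth_on_real_iff[OF open_image deriv_inv'] smooth_deriv_inv by blast

lemma diffeo_image: "diffeo S (g ` S) g"
  unfolding diffeo_def using inj smooth_g smooth_inv by (auto simp: bij_betw_def)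

lemma inverse_increasing_diffeo:
  "increasing_diffeo (g ` S) (inv_into S g) (\<lambda>y. inverse (g' (inv_into S g y)))"
proof
  show "0 < inverse (g' (inv_into S g y))" if "y \<in> g ` S" for y
    using deriv_pos[OF inv_into_into[OF that]] by simp
qed (simp_all only: open_image interval_image smooth_deriv_inv deriv_inv')

lemma inv_image: "inv_into S g ` g ` S = S"
  using inj by (simp add: inv_into_image_cancel)

end

section \<open>The two systems in real partial derivatives\<close>

lemma dx_dy_eqI:
  assumes "(F has_derivative F') (at z)"
  shows "dx F z = F' 1" "dy F z = F' \<i>"
  using frechet_derivative_at[OF assms] by (simp_all add: dx_def dy_def)

lemma has_derivative_dx_dy:
  fixes F :: "complex \<Rightarrow> 'b::real_normed_vector"
  assumes "F differentiable (at z)"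
  shows "(F has_derivative (\<lambda>v. Re v *\<^sub>R dx F z + Im v *\<^sub>R dy F z)) (at z)"
proof -
  have d: "(F has_derivative frechet_derivative F (at z)) (at z)"
    using assms frechet_derivative_works by blast
  then interpret bounded_linear "frechet_derivative F (at z)" by (rule has_derivative_bounded_linear)
  have "frechet_derivative F (at z) v = Re v *\<^sub>R dx F z + Im v *\<^sub>R dy F z" for v
  proof -
    have "v = Re v *\<^sub>R 1 + Im v *\<^sub>R \<i>" by (simp add: complex_eq_iff)
    then have "frechet_derivative F (at z) v = frechet_derivative F (at z) (Re v *\<^sub>R 1 + Im v *\<^sub>R \<i>)"
      by simp
    then show ?thesis unfolding dx_def dy_def by (simp only: add scaleR)
  qed
  then have "frechet_derivative F (at z) = (\<lambda>v. Re v *\<^sub>R dx F z + Im v *\<^sub>R dy F z)" by blast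
  with d show ?thesis by simp
qed

lemma has_derivative_Complex_dx_dy:
  assumes "P differentiable (at z)" "Q differentiable (at z)"
  shows "((\<lambda>w. Complex (P w) (Q w)) has_derivative
    (\<lambda>v. Complex (Re v * dx P z + Im v * dy P z) (Re v * dx Q z + Im v * dy Q z))) (at z)"
  unfolding Complex_eq using has_derivative_dx_dy[OF assms(1)] has_derivative_dx_dy[OF assms(2)]
  by (auto intro!: derivative_eq_intros)

text \<open>The splitting of \<open>F\<close> is asked for only on \<open>D\<close>, so that the
  lemma can be applied again to \<open>dz (cplx f)\<close>, whose real and imaginary parts are known
  only there.\<close>

lemma dz_dzbar_Complex:
  assumes "open D" "z \<in> D" "\<And>w. w \<in> D \<Longrightarrow> F w = Complex (P w) (Q w)"
    and "P differentiable (at z)" "Q differentiable (at z)"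
  shows "dz F z = Complex ((dx P z + dy Q z) / 2) ((dx Q z - dy P z) / 2)"
    and "dzbar F z = Complex ((dx P z - dy Q z) / 2) ((dx Q z + dy P z) / 2)"
proof -
  note d = has_derivative_Complex_dx_dy[OF assms(4,5)]
  have "(F has_derivative
    (\<lambda>v. Complex (Re v * dx P z + Im v * dy P z) (Re v * dx Q z + Im v * dy Q z))) (at z)"
    by (rule has_derivative_transform_within_open[OF d assms(1,2)]) (simp add: assms(3))
  note * = dx_dy_eqI[OF this]
  show "dz F z = Complex ((dx P z + dy Q z) / 2) ((dx Q z - dy P z) / 2)"
    and "dzbar F z = Complex ((dx P z - dy Q z) / 2) ((dx Q z + dy P z) / 2)"
    by (simp_all add: dz_def dzbar_def * complex_eq_iff)
qed

lemma smooth_on_differentiable: "smooth_on D f \<Longrightarrow> z \<in> D \<Longrightarrow> f differentiable (at z)"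
  unfolding smooth_on_def by (metis Ck_on.simps(2))

lemma smooth_on_dx_dy:
  assumes "smooth_on D f"
  shows "smooth_on D (dx f)" "smooth_on D (dy f)"
proof -
  have "\<forall>v. smooth_on D (\<lambda>x. frechet_derivative f (at x) v)"
    using assms unfolding smooth_on_def by (metis Ck_on.simps(2))
  moreover have "dx f = (\<lambda>x. frechet_derivative f (at x) 1)"
    "dy f = (\<lambda>x. frechet_derivative f (at x) \<i>)"
    by (auto simp: dx_def dy_def)
  ultimately show "smooth_on D (dx f)" "smooth_on D (dy f)" by simp_all
qed

lemma dx_dy_cmult:
  fixes P :: "complex \<Rightarrow> real"
  assumes "P differentiable (at z)"
  shows "dx (\<lambda>w. c * P w) z = c * dx P z" "dy (\<lambda>w. c * P w) z = c * dy P z"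
    "(\<lambda>w. c * P w) differentiable (at z)"
proof -
  have "((\<lambda>w. c * P w) has_derivative (\<lambda>v. c * (Re v *\<^sub>R dx P z + Im v *\<^sub>R dy P z))) (at z)"
    using has_derivative_dx_dy[OF assms] by (auto intro!: derivative_eq_intros)
  then show "dx (\<lambda>w. c * P w) z = c * dx P z" "dy (\<lambda>w. c * P w) z = c * dy P z"
    "(\<lambda>w. c * P w) differentiable (at z)"
    by (auto simp: dx_dy_eqI differentiable_def)
qed

text \<open>The two mixed derivatives are kept apart: their equality is to be read off from the
  complex equations.\<close>

lemma wirtinger_real:
  assumes "open D" "smooth_on D f" "z \<in> D"
  shows "dz (cplx f) z = Complex (dx f z / 2) (- dy f z / 2)"
    and "dzbar (cplx f) z = Complex (dx f z / 2) (dy f z / 2)"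
    and "dz (dz (cplx f)) z
      = Complex ((dx (dx f) z - dy (dy f) z) / 4) (- (dx (dy f) z + dy (dx f) z) / 4)"
    and "dzbar (dz (cplx f)) z
      = Complex ((dx (dx f) z + dy (dy f) z) / 4) ((dy (dx f) z - dx (dy f) z) / 4)"
    and "dzbar (dzbar (cplx f)) z
      = Complex ((dx (dx f) z - dy (dy f) z) / 4) ((dx (dy f) z + dy (dx f) z) / 4)"
proof -
  note d = smooth_on_differentiable[OF assms(2)]
  note d' = smooth_on_differentiable[OF smooth_on_dx_dy(1)[OF assms(2)] assms(3)]
    smooth_on_differentiable[OF smooth_on_dx_dy(2)[OF assms(2)] assms(3)]
  have c0: "dx (\<lambda>_. 0 :: real) w = 0" "dy (\<lambda>_. 0 :: real) w = 0" for w
    by (simp_all add: dx_def dy_def)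
  \<comment> \<open>Stated at every point of \<open>D\<close>, because these functions are
    differentiated once more below.\<close>
  have 1: "dz (cplx f) w = Complex (1/2 * dx f w) (- (1/2) * dy f w)"
    "dzbar (cplx f) w = Complex (1/2 * dx f w) (1/2 * dy f w)" if "w \<in> D" for w
    using dz_dzbar_Complex[OF assms(1) that, of "cplx f" f "\<lambda>_. 0"] d[OF that]
    by (auto simp: cplx_def complex_of_real_def c0)
  then show "dz (cplx f) z = Complex (dx f z / 2) (- dy f z / 2)"
    "dzbar (cplx f) z = Complex (dx f z / 2) (dy f z / 2)"
    using assms(3) by auto
  have half: "dx (\<lambda>w. dx f w / 2) z = dx (dx f) z / 2" "dy (\<lambda>w. dx f w / 2) z = dy (dx f) z / 2"
    "dx (\<lambda>w. dy f w / 2) z = dx (dy f) z / 2" "dy (\<lambda>w. dy f w / 2) z = dy (dy f) z / 2"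
    "dx (\<lambda>w. - (dy f w / 2)) z = - (dx (dy f) z / 2)"
    "dy (\<lambda>w. - (dy f w / 2)) z = - (dy (dy f) z / 2)"
    using dx_dy_cmult[OF d'(1), of "1/2"] dx_dy_cmult[OF d'(2), of "1/2"]
      dx_dy_cmult[OF d'(2), of "-1/2"] by simp_all
  note A = dz_dzbar_Complex[OF assms(1,3) 1(1) dx_dy_cmult(3) dx_dy_cmult(3), OF _ d']
  note B = dz_dzbar_Complex[OF assms(1,3) 1(2) dx_dy_cmult(3) dx_dy_cmult(3), OF _ d']
  show "dz (dz (cplx f)) z
      = Complex ((dx (dx f) z - dy (dy f) z) / 4) (- (dx (dy f) z + dy (dx f) z) / 4)"
    "dzbar (dz (cplx f)) z
      = Complex ((dx (dx f) z + dy (dy f) z) / 4) ((dy (dx f) z - dx (dy f) z) / 4)"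
    "dzbar (dzbar (cplx f)) z
      = Complex ((dx (dx f) z - dy (dy f) z) / 4) ((dx (dy f) z + dy (dx f) z) / 4)"
    by (simp_all add: A B half complex_eq_iff field_simps)
qed

lemma dx_dy_compose:
  fixes f :: "complex \<Rightarrow> real"
  assumes "open D" "z \<in> D" "\<And>w. w \<in> D \<Longrightarrow> u w = H (f w)"
    and "f differentiable (at z)" "(H has_real_derivative p) (at (f z))"
  shows "dx u z = p * dx f z" "dy u z = p * dy f z"
proof -
  have "((\<lambda>w. H (f w)) has_derivative (\<lambda>v. p * (Re v *\<^sub>R dx f z + Im v *\<^sub>R dy f z))) (at z)"
    using has_derivative_compose[OF has_derivative_dx_dy[OF assms(4)]] assms(5)
    by (simp add: has_field_derivative_def)
  from has_derivative_transform_within_open[OF this assms(1,2)] assms(3)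
  have "(u has_derivative (\<lambda>v. p * (Re v *\<^sub>R dx f z + Im v *\<^sub>R dy f z))) (at z)"
    by (simp add: eq_commute)
  from dx_dy_eqI[OF this] show "dx u z = p * dx f z" "dy u z = p * dy f z" by simp_all
qed

lemma dx_dy_mult:
  fixes P Q :: "complex \<Rightarrow> real"
  assumes "open D" "z \<in> D" "\<And>w. w \<in> D \<Longrightarrow> F w = P w * Q w"
    and "P differentiable (at z)" "Q differentiable (at z)"
  shows "dx F z = P z * dx Q z + dx P z * Q z" "dy F z = P z * dy Q z + dy P z * Q z"
proof -
  have "((\<lambda>w. P w * Q w) has_derivative
      (\<lambda>v. P z * (Re v *\<^sub>R dx Q z + Im v *\<^sub>R dy Q z) + (Re v *\<^sub>R dx P z + Im v *\<^sub>R dy P z) * Q z)) (at z)"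
    by (intro has_derivative_mult has_derivative_dx_dy assms)
  from has_derivative_transform_within_open[OF this assms(1,2)] assms(3)
  have "(F has_derivative
      (\<lambda>v. P z * (Re v *\<^sub>R dx Q z + Im v *\<^sub>R dy Q z) + (Re v *\<^sub>R dx P z + Im v *\<^sub>R dy P z) * Q z)) (at z)"
    by (simp add: eq_commute)
  from dx_dy_eqI[OF this] show "dx F z = P z * dx Q z + dx P z * Q z"
    "dy F z = P z * dy Q z + dy P z * Q z" by simp_all
qed

text \<open>Here \<open>p\<close> is H' and \<open>q\<close> is H'' at f z. The formula for the
  first derivatives holds on all of \<open>D\<close>, so the product rule can be applied to
  it.\<close>

lemma second_derivatives_compose:
  fixes f :: "complex \<Rightarrow> real"
  assumes "open D" "z \<in> D" "smooth_on D f" "\<And>w. w \<in> D \<Longrightarrow> u w = H (f w)"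
    and "\<And>w. w \<in> D \<Longrightarrow> (H has_real_derivative p (f w)) (at (f w))"
    and "(p has_real_derivative q) (at (f z))"
  shows "dx (dx u) z = q * (dx f z)\<^sup>2 + p (f z) * dx (dx f) z"
    and "dy (dx u) z = q * (dx f z * dy f z) + p (f z) * dy (dx f) z"
    and "dx (dy u) z = q * (dx f z * dy f z) + p (f z) * dx (dy f) z"
    and "dy (dy u) z = q * (dy f z)\<^sup>2 + p (f z) * dy (dy f) z"
proof -
  note d = smooth_on_differentiable[OF assms(3)]
  note d' = smooth_on_differentiable[OF smooth_on_dx_dy(1)[OF assms(3)] assms(2)]
    smooth_on_differentiable[OF smooth_on_dx_dy(2)[OF assms(3)] assms(2)]
  have 1: "dx u w = p (f w) * dx f w" "dy u w = p (f w) * dy f w" if "w \<in> D" for w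
    using dx_dy_compose[OF assms(1) that, of u H f] assms(4) d[OF that] assms(5)[OF that] by auto
  have pf: "(\<lambda>w. p (f w)) differentiable (at z)"
    using has_derivative_compose[OF has_derivative_dx_dy[OF d[OF assms(2)]]] assms(6)
    by (auto simp: has_field_derivative_def differentiable_def)
  have 2: "dx (\<lambda>w. p (f w)) z = q * dx f z" "dy (\<lambda>w. p (f w)) z = q * dy f z"
    using dx_dy_compose[OF assms(1,2), of "\<lambda>w. p (f w)" p f] d[OF assms(2)] assms(6) by auto
  note A = dx_dy_mult[OF assms(1,2) 1(1) pf d'(1)] dx_dy_mult[OF assms(1,2) 1(2) pf d'(2)]
  show "dx (dx u) z = q * (dx f z)\<^sup>2 + p (f z) * dx (dx f) z"
    "dy (dx u) z = q * (dx f z * dy f z) + p (f z) * dy (dx f) z"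
    "dx (dy u) z = q * (dx f z * dy f z) + p (f z) * dx (dy f) z"
    "dy (dy u) z = q * (dy f z)\<^sup>2 + p (f z) * dy (dy f) z"
    by (simp_all add: A 2 power2_eq_square)
qed

text \<open>
  Symmetry of the mixed partial derivatives is the imaginary part of the complex equations: in System 1
  \<open>dzbar (dz f)\<close> is a real multiple of \<open>dz f * dzbar f\<close>, in System 2 \<open>dzbar (dz u) = 0\<close>.
\<close>

definition eqns1 :: "(complex \<Rightarrow> real) \<Rightarrow> complex \<Rightarrow> real \<Rightarrow> bool" where
  "eqns1 f z h \<longleftrightarrow> (dx f z)\<^sup>2 + (dy f z)\<^sup>2 > 0 \<and> dx (dy f) z = dy (dx f) z \<and>
     dx (dx f) z + dy (dy f) z = h * ((dx f z)\<^sup>2 + (dy f z)\<^sup>2) \<and>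
     (1 + (dy f z)\<^sup>2) * dx (dx f) z - 2 * dy (dx f) z * dx f z * dy f z
       + (1 + (dx f z)\<^sup>2) * dy (dy f) z = 0"

text \<open>The numerator in System 2 is one eighth of the last left-hand side and its denominator
  is a quarter of the squared gradient; hence the factor 2 before \<open>j\<close>.\<close>

definition eqns2 :: "(complex \<Rightarrow> real) \<Rightarrow> complex \<Rightarrow> real \<Rightarrow> bool" where
  "eqns2 u z j \<longleftrightarrow> (dx u z)\<^sup>2 + (dy u z)\<^sup>2 > 0 \<and> dx (dy u) z = dy (dx u) z \<and>
     dx (dx u) z + dy (dy u) z = 0 \<and>
     ((dx u z)\<^sup>2 - (dy u z)\<^sup>2) * (dx (dx u) z - dy (dy u) z) + 4 * dx u z * dy u z * dy (dx u) z
       = 2 * j * ((dx u z)\<^sup>2 + (dy u z)\<^sup>2)"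

lemma Complex_eq_0_iff_half: "Complex (a / 2) (- b / 2) = 0 \<longleftrightarrow> \<not> a\<^sup>2 + b\<^sup>2 > 0"
  "Complex (a / 2) (b / 2) = 0 \<longleftrightarrow> \<not> a\<^sup>2 + b\<^sup>2 > 0"
  by (simp_all add: complex_eq_iff sum_power2_gt_zero_iff)

lemma Complex_conj_mult: "Complex (a / 2) (- b / 2) * Complex (a / 2) (b / 2) = of_real ((a\<^sup>2 + b\<^sup>2) / 4)"
  by (simp add: complex_eq_iff power2_eq_square add_divide_distrib)

text \<open>Once the mixed derivatives agree, the left side of the first complex equation is - 1/4
  times the minimal surface expression, so minimality and that equation are one condition. The
  quotient equation supplies the agreement.\<close>

lemma system1_iff:
  "system1 D I f h \<longleftrightarrow>
     open D \<and> smooth_on D f \<and> I = f ` D \<and> is_interval I \<and>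
     smooth_on I h \<and> (\<forall>t\<in>I. h t \<noteq> 0) \<and> sign_definite_on I h \<and> (\<forall>z\<in>D. eqns1 f z (h (f z)))"
proof (cases "open D \<and> smooth_on D f")
  case True
  have "(dz (cplx f) z \<noteq> 0 \<and> dzbar (cplx f) z \<noteq> 0 \<and>
        dz (dz (cplx f)) z * (dzbar (cplx f) z)\<^sup>2 + dzbar (dzbar (cplx f)) z * (dz (cplx f) z)\<^sup>2
          - dzbar (dz (cplx f)) z * (1 + 2 * dz (cplx f) z * dzbar (cplx f) z) = 0 \<and>
        dzbar (dz (cplx f)) z / (dz (cplx f) z * dzbar (cplx f) z) = complex_of_real k) \<and>
      ((1 + (dy f z)\<^sup>2) * dx (dx f) z - 2 * dy (dx f) z * dx f z * dy f z
            + (1 + (dx f z)\<^sup>2) * dy (dy f) z = 0) \<longleftrightarrow> eqns1 f z k" if "z \<in> D" for z k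
  proof -
    let ?a = "dx f z" and ?b = "dy f z" and ?A = "dx (dx f) z" and ?B = "dy (dy f) z"
      and ?C = "dy (dx f) z" and ?C' = "dx (dy f) z"
    show ?thesis
    proof (cases "?a\<^sup>2 + ?b\<^sup>2 > 0")
      case pos: True
      \<comment> \<open>The denominator and the right-hand side are real: the imaginary part gives
        the symmetry, the real part the equation for the Laplacian.\<close>
      have h: "Complex ((?A + ?B) / 4) ((?C - ?C') / 4) / of_real ((?a\<^sup>2 + ?b\<^sup>2) / 4) = of_real k
          \<longleftrightarrow> ?C' = ?C \<and> ?A + ?B = k * (?a\<^sup>2 + ?b\<^sup>2)"
        using pos by (auto simp: complex_eq_iff Re_divide_of_real Im_divide_of_real field_simps)
      let ?lhs = "Complex ((?A - ?B) / 4) (- (?C' + ?C) / 4) * (Complex (?a / 2) (?b / 2))\<^sup>2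
          + Complex ((?A - ?B) / 4) ((?C' + ?C) / 4) * (Complex (?a / 2) (- ?b / 2))\<^sup>2
          - Complex ((?A + ?B) / 4) ((?C - ?C') / 4)
            * (1 + 2 * Complex (?a / 2) (- ?b / 2) * Complex (?a / 2) (?b / 2))"
      have "?lhs = of_real (- ((1 + ?b\<^sup>2) * ?A - 2 * ?C * ?a * ?b + (1 + ?a\<^sup>2) * ?B) / 4)" if "?C' = ?C"
        by (rule complex_eqI) (simp_all add: that power2_eq_square field_simps)
      then have "?lhs = 0 \<longleftrightarrow> (1 + ?b\<^sup>2) * ?A - 2 * ?C * ?a * ?b + (1 + ?a\<^sup>2) * ?B = 0"
        if "?C' = ?C"
        using that
        by (simp only: of_real_eq_0_iff divide_eq_0_iff neg_equal_0_iff_equal numeral_neq_zero simp_thms)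
      then show ?thesis
        unfolding wirtinger_real[OF conjunct1[OF True] conjunct2[OF True] \<open>z \<in> D\<close>]
          Complex_eq_0_iff_half eqns1_def Complex_conj_mult h power2_minus
        using pos by blast
    next
      \<comment> \<open>With vanishing gradient both sides of the equivalence are false.\<close>
      case False
      then have "dzbar (cplx f) z = 0"
        using wirtinger_real(2)[OF conjunct1[OF True] conjunct2[OF True] \<open>z \<in> D\<close>]
          Complex_eq_0_iff_half(2) by simp
      then show ?thesis using False by (simp add: eqns1_def)
    qed
  qed
  with True show ?thesis unfolding system1_def minimal_graph_on_def by blast
qed (auto simp: system1_def minimal_graph_on_def)

text \<open>Both the Laplace equation and the symmetry of the mixed derivatives are parts of the
  single equation \<open>dzbar (dz (cplx u)) z = 0\<close>; given the symmetry, the numerator of the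
  quotient is real.\<close>

lemma system2_iff:
  "system2 D J u j \<longleftrightarrow>
     open D \<and> smooth_on D u \<and> J = u ` D \<and> is_interval J \<and>
     smooth_on J j \<and> (\<forall>s\<in>J. j s \<noteq> 0) \<and> sign_definite_on J j \<and> (\<forall>z\<in>D. eqns2 u z (j (u z)))"
proof (cases "open D \<and> smooth_on D u")
  case True
  have "(dz (cplx u) z \<noteq> 0 \<and> dzbar (cplx u) z \<noteq> 0 \<and>
        dzbar (dz (cplx u)) z = 0 \<and>
        ((dz (cplx u) z)\<^sup>2 * dzbar (dzbar (cplx u)) z + (dzbar (cplx u) z)\<^sup>2 * dz (dz (cplx u)) z)
          / (dz (cplx u) z * dzbar (cplx u) z) = complex_of_real k) \<and>
      dx (dx u) z + dy (dy u) z = 0 \<longleftrightarrow> eqns2 u z k" if "z \<in> D" for z k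
  proof -
    let ?a = "dx u z" and ?b = "dy u z" and ?A = "dx (dx u) z" and ?B = "dy (dy u) z"
      and ?C = "dy (dx u) z" and ?C' = "dx (dy u) z"
    show ?thesis
    proof (cases "?a\<^sup>2 + ?b\<^sup>2 > 0")
      case pos: True
      let ?num = "(Complex (?a / 2) (- ?b / 2))\<^sup>2 * Complex ((?A - ?B) / 4) ((?C' + ?C) / 4)
          + (Complex (?a / 2) (?b / 2))\<^sup>2 * Complex ((?A - ?B) / 4) (- (?C' + ?C) / 4)"
      have "?num = of_real (((?a\<^sup>2 - ?b\<^sup>2) * (?A - ?B) + 4 * ?a * ?b * ?C) / 8)" if "?C' = ?C"
        by (rule complex_eqI) (simp_all add: that power2_eq_square field_simps)
      moreover have "complex_of_real (x / 8) / of_real ((?a\<^sup>2 + ?b\<^sup>2) / 4) = of_real k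
          \<longleftrightarrow> x = 2 * k * (?a\<^sup>2 + ?b\<^sup>2)" for x
      proof -
        have "x / 8 / ((?a\<^sup>2 + ?b\<^sup>2) / 4) = k \<longleftrightarrow> x = 2 * k * (?a\<^sup>2 + ?b\<^sup>2)"
          using pos by (auto simp: field_simps)
        then show ?thesis by (simp only: of_real_divide[symmetric] of_real_eq_iff)
      qed
      ultimately have "?num / of_real ((?a\<^sup>2 + ?b\<^sup>2) / 4) = of_real k \<longleftrightarrow>
          (?a\<^sup>2 - ?b\<^sup>2) * (?A - ?B) + 4 * ?a * ?b * ?C = 2 * k * (?a\<^sup>2 + ?b\<^sup>2)" if "?C' = ?C"
        using that by (simp only:)
      moreover have "Complex ((?A + ?B) / 4) ((?C - ?C') / 4) = 0 \<longleftrightarrow> ?C' = ?C \<and> ?A + ?B = 0"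
        by (auto simp: complex_eq_iff)
      ultimately show ?thesis
        unfolding wirtinger_real[OF conjunct1[OF True] conjunct2[OF True] \<open>z \<in> D\<close>]
          Complex_eq_0_iff_half eqns2_def Complex_conj_mult power2_minus
        using pos by blast
    next
      case False
      then have "dzbar (cplx u) z = 0"
        using wirtinger_real(2)[OF conjunct1[OF True] conjunct2[OF True] \<open>z \<in> D\<close>]
          Complex_eq_0_iff_half(2) by simp
      then show ?thesis using False by (simp add: eqns2_def)
    qed
  qed
  with True show ?thesis unfolding system2_def harmonic_on_def by blast
qed (auto simp: system2_def harmonic_on_def)

section \<open>The transfer between the two systems at a point\<close>

lemma eqns1_iff_eqns2:
  fixes f :: "complex \<Rightarrow> real"
  assumes "open D" "z \<in> D" "smooth_on D f" "\<And>w. w \<in> D \<Longrightarrow> u w = H (f w)"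
    and "\<And>w. w \<in> D \<Longrightarrow> (H has_real_derivative p (f w)) (at (f w))"
    and "(p has_real_derivative - h * p (f z)) (at (f z))" "p (f z) > 0"
  shows "eqns1 f z h \<longleftrightarrow> eqns2 u z (h * p (f z))"
proof -
  note d = dx_dy_compose[OF assms(1,2,4) smooth_on_differentiable[OF assms(3,2)] assms(5)[OF assms(2)]]
    second_derivatives_compose[OF assms(1-6)]
  have d': "dx u z = p (f z) * dx f z" "dy u z = p (f z) * dy f z"
    "dx (dx u) z = - h * p (f z) * (dx f z)\<^sup>2 + p (f z) * dx (dx f) z"
    "dy (dx u) z = - h * p (f z) * (dx f z * dy f z) + p (f z) * dy (dx f) z"
    "dx (dy u) z = - h * p (f z) * (dx f z * dy f z) + p (f z) * dx (dy f) z"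
    "dy (dy u) z = - h * p (f z) * (dy f z)\<^sup>2 + p (f z) * dy (dy f) z"
    using d by simp_all
  define a b A B C C' P where
    "a = dx f z" "b = dy f z" "A = dx (dx f) z" "B = dy (dy f) z" "C = dy (dx f) z" "C' = dx (dy f) z"
    "P = p (f z)"
  have P: "P > 0" using assms(7) by (simp add: \<open>P = p (f z)\<close>)
  have 1: "(P * a)\<^sup>2 + (P * b)\<^sup>2 = P\<^sup>2 * (a\<^sup>2 + b\<^sup>2)" by (simp add: power_mult_distrib algebra_simps)
  have 2: "- h * P * (a * b) + P * C' = - h * P * (a * b) + P * C \<longleftrightarrow> C' = C" using P by simp
  \<comment> \<open>The Laplacian of u is H' times the defect in the equation for the Laplacian of
    f.\<close>
  have "- h * P * a\<^sup>2 + P * A + (- h * P * b\<^sup>2 + P * B) = P * (A + B - h * (a\<^sup>2 + b\<^sup>2))"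
    by (simp add: algebra_simps)
  then have 3: "- h * P * a\<^sup>2 + P * A + (- h * P * b\<^sup>2 + P * B) = 0 \<longleftrightarrow> A + B = h * (a\<^sup>2 + b\<^sup>2)"
    using P by simp
  \<comment> \<open>Modulo the Laplace equation, the defect of the last equation for u is - 2 H'^3
    times the minimal surface expression of f. As H' is positive, the two vanish together.\<close>
  have "((P * a)\<^sup>2 - (P * b)\<^sup>2) * (- h * P * a\<^sup>2 + P * A - (- h * P * b\<^sup>2 + P * B))
        + 4 * (P * a) * (P * b) * (- h * P * (a * b) + P * C)
      - 2 * (h * P) * (P\<^sup>2 * (a\<^sup>2 + b\<^sup>2))
    = - 2 * P ^ 3 * ((1 + b\<^sup>2) * A - 2 * C * a * b + (1 + a\<^sup>2) * B)"
    if "A + B = h * (a\<^sup>2 + b\<^sup>2)"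
  proof -
    have B: "B = h * (a\<^sup>2 + b\<^sup>2) - A" using that by simp
    show ?thesis unfolding B by algebra
  qed
  then have 4: "((P * a)\<^sup>2 - (P * b)\<^sup>2) * (- h * P * a\<^sup>2 + P * A - (- h * P * b\<^sup>2 + P * B))
        + 4 * (P * a) * (P * b) * (- h * P * (a * b) + P * C)
      = 2 * (h * P) * (P\<^sup>2 * (a\<^sup>2 + b\<^sup>2))
    \<longleftrightarrow> (1 + b\<^sup>2) * A - 2 * C * a * b + (1 + a\<^sup>2) * B = 0"
    if "A + B = h * (a\<^sup>2 + b\<^sup>2)"
    using that P by (smt (verit, best) mult_eq_0_iff zero_less_power)
  have 0: "P\<^sup>2 * (a\<^sup>2 + b\<^sup>2) > 0 \<longleftrightarrow> a\<^sup>2 + b\<^sup>2 > 0" using P by (simp add: zero_less_mult_iff)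
  show ?thesis
    unfolding eqns1_def eqns2_def d' a_b_A_B_C_C'_P_def[symmetric] 1 2 3 0
    using 4 by blast
qed

section \<open>The forward transformation\<close>

lemma open_range:
  fixes f :: "complex \<Rightarrow> real"
  assumes "open D" "smooth_on D f" "is_interval (f ` D)"
    and nz: "\<And>z. z \<in> D \<Longrightarrow> (dx f z)\<^sup>2 + (dy f z)\<^sup>2 > 0"
  shows "open (f ` D)"
proof (rule open_image_if_derivative_nonzero[OF assms(1,3)])
  show "(f has_derivative (\<lambda>v. Re v *\<^sub>R dx f z + Im v *\<^sub>R dy f z)) (at z)" if "z \<in> D" for z
    using has_derivative_dx_dy smooth_on_differentiable assms(2) that by blast
  show "\<exists>v. Re v *\<^sub>R dx f z + Im v *\<^sub>R dy f z \<noteq> 0" if "z \<in> D" for z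
  proof -
    have "dx f z \<noteq> 0 \<or> dy f z \<noteq> 0" using nz[OF that] by auto
    then show ?thesis
    proof
      assume "dx f z \<noteq> 0" then show ?thesis by (intro exI[of _ 1]) simp
    next
      assume "dy f z \<noteq> 0" then show ?thesis by (intro exI[of _ \<i>]) simp
    qed
  qed
qed

text \<open>A nonvanishing gradient makes the range open. Two-sided derivatives and smoothness on it
  then have their intended meaning.\<close>

lemma system1_open:
  assumes "system1 D I f h"
  shows "open I"
proof -
  have "open (f ` D)"
    by (rule open_range) (use assms in \<open>auto simp: system1_iff eqns1_def\<close>)
  then show ?thesis using assms by (simp add: system1_iff)
qed

lemma system2_open:
  assumes "system2 D J u j"
  shows "open J"
proof -
  have "open (u ` D)"
    by (rule open_range) (use assms in \<open>auto simp: system2_iff eqns2_def\<close>)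
  then show ?thesis using assms by (simp add: system2_iff)
qed

lemma sgn_sign_definite_on:
  "sign_definite_on S g \<Longrightarrow> x \<in> S \<Longrightarrow> y \<in> S \<Longrightarrow> sgn (g x) = sgn (g y)"
  by (auto simp: sign_definite_on_def)

lemma forward_increasing_diffeo:
  assumes "open I" "is_interval I" "smooth_on I h"
    and "antiderivative_on I h H1" "antiderivative_on I (\<lambda>t. exp (- H1 t)) H"
  shows "increasing_diffeo I H (\<lambda>t. exp (- H1 t))"
proof
  show "smooth_on I (\<lambda>t. exp (- H1 t))"
    using smooth_on_compose[OF assms(1) open_UNIV antiderivative_on_smooth[OF assms(1,3,4)]
        smooth_on_uminus_exp] by simp
qed (use assms in \<open>auto simp: antiderivative_on_def\<close>)

text \<open>This is H'' = - h H' for the forward H.\<close>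

lemma forward_deriv2:
  assumes "antiderivative_on I h H1" "t \<in> I"
  shows "((\<lambda>t. exp (- H1 t)) has_real_derivative - h t * exp (- H1 t)) (at t)"
  using assms unfolding antiderivative_on_def by (auto intro!: derivative_eq_intros)

text \<open>Since 1 / K' equals H' at K, the quotient defining j becomes the product h H' that the
  transfer produces.\<close>

lemma (in increasing_diffeo) forward_j_eq:
  assumes "s \<in> g ` S"
  shows "forward_j S h g s = h (inv_into S g s) * g' (inv_into S g s)"
  using DERIV_imp_deriv[OF deriv_inv'[OF assms]] by (simp add: forward_j_def Let_def divide_inverse)

lemma (in increasing_diffeo) forward_j_image:
  "t \<in> S \<Longrightarrow> forward_j S h g (g t) = h t * g' t"
  using inj by (simp add: forward_j_eq)

lemma forward_H_exists:
  assumes "open I" "is_interval I" "smooth_on I h"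
  shows "\<exists>H. forward_H I h H"
proof -
  obtain H1 where H1: "antiderivative_on I h H1"
    using antiderivative_on_exists[OF assms(1,2) smooth_on_continuous_on[OF assms(3)]] by blast
  have "continuous_on I (\<lambda>t. exp (- H1 t))"
    using smooth_on_continuous_on[OF antiderivative_on_smooth[OF assms(1,3) H1]]
    by (intro continuous_intros)
  with H1 show ?thesis
    using antiderivative_on_exists[OF assms(1,2)] unfolding forward_H_def by blast
qed

lemma system1_imp_system2:
  assumes sys: "system1 D I f h" and H: "forward_H I h H"
  shows "\<forall>t\<in>I. deriv H t > 0" "diffeo I (H ` I) H"
    "system2 D (H ` I) (H \<circ> f) (forward_j I h H)"
    "\<forall>t\<in>I. \<forall>s\<in>H ` I. sgn (forward_j I h H s) = sgn (h t)"
proof -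
  obtain H1 where H1: "antiderivative_on I h H1" "antiderivative_on I (\<lambda>t. exp (- H1 t)) H"
    using H by (auto simp: forward_H_def)
  have op: "open I" using sys by (rule system1_open)
  have D: "open D" "smooth_on D f" "I = f ` D" "is_interval I" "smooth_on I h"
    "\<And>t. t \<in> I \<Longrightarrow> h t \<noteq> 0" "sign_definite_on I h" "\<And>z. z \<in> D \<Longrightarrow> eqns1 f z (h (f z))"
    using sys by (auto simp: system1_iff)
  interpret increasing_diffeo I H "\<lambda>t. exp (- H1 t)"
    by (rule forward_increasing_diffeo[OF op D(4,5) H1])
  show "\<forall>t\<in>I. deriv H t > 0"
    using DERIV_imp_deriv[OF deriv_g] by simp
  show "diffeo I (H ` I) H" by (rule diffeo_image)
  have sgn_eq: "sgn (forward_j I h H (H t)) = sgn (h t)" if "t \<in> I" for t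
    using that by (simp add: forward_j_image sgn_mult)
  \<comment> \<open>The factor H' is positive, which settles corresponding points; sign-definiteness
    of \<open>h\<close> then covers all pairs.\<close>
  show sgn: "\<forall>t\<in>I. \<forall>s\<in>H ` I. sgn (forward_j I h H s) = sgn (h t)"
  proof (intro ballI)
    fix t s assume "t \<in> I" "s \<in> H ` I"
    then obtain t' where "t' \<in> I" "s = H t'" by blast
    then show "sgn (forward_j I h H s) = sgn (h t)"
      using sgn_eq sgn_sign_definite_on[OF D(7) _ \<open>t \<in> I\<close>] by simp
  qed
  have sm: "smooth_on (H ` I) (forward_j I h H)"
  proof -
    have "inv_into I H ` H ` I \<subseteq> I" by (simp add: inv_image)
    then have "smooth_on (H ` I) (\<lambda>s. h (inv_into I H s) * exp (- H1 (inv_into I H s)))"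
      using smooth_on_compose[OF open_image op smooth_inv]
      by (intro smooth_on_mult open_image) (use D(5) smooth_g' in blast)+
    then show ?thesis by (rule iffD2[OF smooth_on_cong[OF open_image forward_j_eq], rotated])
  qed
  have "eqns2 (H \<circ> f) z (forward_j I h H ((H \<circ> f) z))" if "z \<in> D" for z
  proof -
    have t: "f w \<in> I" if "w \<in> D" for w using that D(3) by simp
    have "eqns2 (H \<circ> f) z (h (f z) * exp (- H1 (f z)))"
      using eqns1_iff_eqns2[OF D(1) that D(2), of "H \<circ> f" H "\<lambda>t. exp (- H1 t)" "h (f z)"]
        D(8)[OF that] deriv_g[OF t] forward_deriv2[OF H1(1) t[OF that]] by simp
    then show ?thesis using forward_j_image t[OF that] by simp
  qed
  moreover have "smooth_on D (H \<circ> f)"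
    using smooth_on_compose[OF D(1) op D(2) smooth_g] D(3) by (simp add: comp_def)
  moreover have "forward_j I h H s \<noteq> 0" if "s \<in> H ` I" for s
    using that D(6) by (auto simp: forward_j_image)
  moreover have "sign_definite_on (H ` I) (forward_j I h H)"
    using D(7) by (auto simp: sign_definite_on_def forward_j_image zero_less_mult_iff mult_less_0_iff)
  ultimately show "system2 D (H ` I) (H \<circ> f) (forward_j I h H)"
    using D(1,3) interval_image sm by (auto simp: system2_iff image_comp)
qed

text \<open>The equations are local and preimages of open sets are open. The range is all of
  \<open>J0\<close> because \<open>J0\<close> lies in the range of \<open>u\<close>.\<close>

lemma system2_restrict:
  assumes sys: "system2 D J u j" and "open J0" "is_interval J0" "J0 \<subseteq> J"
  shows "system2 (sub_domain D u J0) J0 u j"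
proof -
  have D: "open D" "smooth_on D u" "J = u ` D"
    using sys by (auto simp: system2_iff)
  have sub: "sub_domain D u J0 = D \<inter> u -` J0" by (auto simp: sub_domain_def)
  then have "open (sub_domain D u J0)"
    using continuous_open_preimage[OF smooth_on_continuous_on[OF D(2)] D(1) assms(2)] by simp
  moreover have "J0 = u ` sub_domain D u J0" using assms(4) D(3) by (auto simp: sub_domain_def)
  moreover have "smooth_on (sub_domain D u J0) u" "smooth_on J0 j"
    using sys assms(4) sub by (auto intro: smooth_on_subset simp: system2_iff)
  moreover have "sign_definite_on J0 j"
    using sys assms(4) by (auto simp: system2_iff sign_definite_on_def)
  ultimately show ?thesis
    using sys assms(3,4) unfolding system2_iff by (auto simp: sub_domain_def)
qed

section \<open>The converse transformation\<close>

text \<open>The data of the converse construction, separated from u and its domain.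
  \<open>C2\<close> is an arbitrary translation.\<close>

locale converse_data =
  fixes J0 :: "real set" and j A :: "real \<Rightarrow> real" and C1 :: real and j2 :: "real \<Rightarrow> real" and C2 :: real
  assumes open_J0: "open J0" and interval_J0: "is_interval J0"
    and smooth_j: "smooth_on J0 j"
    and deriv_A: "s \<in> J0 \<Longrightarrow> (A has_real_derivative j s) (at s)"
    and pos: "s \<in> J0 \<Longrightarrow> conv_j1 A C1 s > 0"
    and j2: "conv_j2 A C1 J0 j2"
begin

abbreviation "I \<equiv> conv_I J0 j2 C2"
abbreviation "H \<equiv> conv_H J0 j2 C2"
abbreviation "h \<equiv> conv_h J0 j2 C2"
text \<open>H inverts \<open>j2 - C2\<close>, whose derivative is 1 / sqrt j1, so this is the
  expected H'.\<close>

abbreviation "dH \<equiv> \<lambda>t. sqrt (conv_j1 A C1 (H t))"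

lemma deriv_j1: "s \<in> J0 \<Longrightarrow> (conv_j1 A C1 has_real_derivative - 2 * j s) (at s)"
  unfolding conv_j1_def using deriv_A by (auto intro!: derivative_eq_intros)

lemma smooth_sqrt_j1: "smooth_on J0 (\<lambda>s. sqrt (conv_j1 A C1 s))"
proof -
  have "smooth_on J0 (\<lambda>s. - 2 * j s)"
    by (intro smooth_on_mult open_J0 smooth_j) (simp add: smooth_on_def Ck_on_const)
  then have "smooth_on J0 (conv_j1 A C1)"
    using smooth_on_real_iff[OF open_J0 deriv_j1] by blast
  then show ?thesis
    by (rule smooth_on_compose[OF open_J0 open_greaterThan _ smooth_on_sqrt]) (use pos in auto)
qed

lemma smooth_inverse_sqrt_j1: "smooth_on J0 (\<lambda>s. 1 / sqrt (conv_j1 A C1 s))"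
proof -
  have "open (- {0::real})" by auto
  then have "smooth_on J0 (\<lambda>s. inverse (sqrt (conv_j1 A C1 s)))"
    by (rule smooth_on_compose[OF open_J0 _ smooth_sqrt_j1 smooth_on_inverse]) (use pos in force)
  then show ?thesis by (simp add: inverse_eq_divide)
qed

text \<open>The shift \<open>c\<close> is free because two cases are wanted: 0 for \<open>j2\<close>
  itself, and \<open>C2\<close> for the function inverted by H.\<close>

lemma increasing_diffeo_shift: "increasing_diffeo J0 (\<lambda>s. j2 s - c) (\<lambda>s. 1 / sqrt (conv_j1 A C1 s))"
proof
  fix s assume "s \<in> J0"
  then show "((\<lambda>s. j2 s - c) has_real_derivative 1 / sqrt (conv_j1 A C1 s)) (at s)"
    using j2 unfolding conv_j2_def antiderivative_on_def by (auto intro!: derivative_eq_intros)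
  show "0 < 1 / sqrt (conv_j1 A C1 s)" using pos[OF \<open>s \<in> J0\<close>] by simp
qed (rule open_J0 interval_J0 smooth_inverse_sqrt_j1)+

sublocale j2: increasing_diffeo J0 j2 "\<lambda>s. 1 / sqrt (conv_j1 A C1 s)"
  using increasing_diffeo_shift[of 0] by simp

sublocale j2': increasing_diffeo J0 "\<lambda>s. j2 s - C2" "\<lambda>s. 1 / sqrt (conv_j1 A C1 s)"
  by (rule increasing_diffeo_shift)

lemma conv_H_j2: "s \<in> J0 \<Longrightarrow> H (j2 s - C2) = s"
  using j2.inj by (simp add: conv_H_def conv_j3_def)

lemma conv_H_eq_inv: "t \<in> I \<Longrightarrow> H t = inv_into J0 (\<lambda>s. j2 s - C2) t"
  using conv_H_j2 inv_into_f_f[OF j2'.inj] by (auto simp: conv_I_def)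

lemma conv_H_in: "t \<in> I \<Longrightarrow> H t \<in> J0"
  using conv_H_j2 by (auto simp: conv_I_def)

lemma image_conv_H: "H ` I = J0"
  using conv_H_j2 by (force simp: conv_I_def image_image)

lemma open_I: "open I"
  using j2'.open_image by (simp add: conv_I_def)

lemma deriv_conv_H: assumes "t \<in> I" shows "(H has_real_derivative dH t) (at t)"
proof -
  have "(inv_into J0 (\<lambda>s. j2 s - C2) has_real_derivative dH t) (at t)"
    using j2'.deriv_inv'[of t] assms by (simp add: conv_I_def conv_H_eq_inv)
  \<comment> \<open>H agrees with the inverse of the shifted function only on the open set
    \<open>I\<close>, which is enough for derivatives there.\<close>
  then show ?thesis
    by (rule has_field_derivative_transform_within_open[OF _ open_I assms]) (simp add: conv_H_eq_inv)
qed

sublocale H: increasing_diffeo I H dH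
proof
  have "smooth_on I (inv_into J0 (\<lambda>s. j2 s - C2))"
    using j2'.smooth_inv by (simp add: conv_I_def)
  then have H: "smooth_on I H"
    by (rule iffD2[OF smooth_on_cong[OF open_I conv_H_eq_inv], rotated])
  show "smooth_on I dH"
    by (rule smooth_on_compose[OF open_I open_J0 H smooth_sqrt_j1]) (simp add: image_conv_H)
  show "is_interval I" using j2'.interval_image by (simp add: conv_I_def)
qed (use open_I deriv_conv_H pos conv_H_in in auto)

text \<open>Differentiating the root gives - 2 j(H) H' / (2 sqrt j1(H)), and H' cancels the root:
  H'' = - j(H).\<close>

lemma deriv_dH:
  assumes "t \<in> I"
  shows "(dH has_real_derivative - j (H t)) (at t)"
proof -
  have p: "conv_j1 A C1 (H t) > 0" using pos conv_H_in assms by blast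
  have "((\<lambda>t. conv_j1 A C1 (H t)) has_real_derivative - 2 * j (H t) * dH t) (at t)"
    using DERIV_chain2[OF deriv_j1[OF conv_H_in[OF assms]] deriv_conv_H[OF assms]] .
  from DERIV_chain2[OF DERIV_real_sqrt[OF p] this] show ?thesis
    by (rule DERIV_cong) (use p in \<open>simp add: field_simps\<close>)
qed

lemma conv_h_eq:
  assumes "t \<in> I"
  shows "h t = j (H t) / dH t"
proof -
  \<comment> \<open>\<open>deriv H\<close> coincides with \<open>dH\<close> on a neighbourhood of
    \<open>t\<close>, so the iterated \<open>deriv\<close> in the definition of h can be
    evaluated.\<close>
  have "(deriv H has_real_derivative - j (H t)) (at t)"
    by (rule has_field_derivative_transform_within_open[OF deriv_dH[OF assms] open_I assms])
      (simp add: DERIV_imp_deriv[OF deriv_conv_H])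
  then show ?thesis
    by (simp add: conv_h_def DERIV_imp_deriv[OF deriv_conv_H[OF assms]] DERIV_imp_deriv)
qed

lemma conv_h_dH: "t \<in> I \<Longrightarrow> h t * dH t = j (H t)"
  using H.deriv_pos[of t] by (simp add: conv_h_eq)

text \<open>With H1 = - ln H' one has H1' = - H'' / H' = h, and exp (- H1) is H' itself. Thus H is
  an admissible choice in the forward transformation, which leads back to the given j.\<close>

lemma forward_H_conv: "forward_H I h H"
proof -
  have e: "exp (- (- ln (dH t))) = dH t" if "t \<in> I" for t
    using H.deriv_pos[OF that] by simp
  have "((\<lambda>t. - ln (dH t)) has_real_derivative h t) (at t)" if "t \<in> I" for t
    using DERIV_minus[OF DERIV_chain2[OF DERIV_ln[OF H.deriv_pos[OF that]] deriv_dH[OF that]]]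
    by (simp add: conv_h_eq[OF that] divide_inverse mult.commute)
  then show ?thesis
    unfolding forward_H_def antiderivative_on_def using deriv_conv_H e
    by (intro exI[of _ "\<lambda>t. - ln (dH t)"]) simp
qed

lemma forward_j_conv: "s \<in> J0 \<Longrightarrow> forward_j I h H s = j s"
  using H.forward_j_image conv_h_dH image_conv_H by (metis imageE)

lemma conv_f_in: "u z \<in> J0 \<Longrightarrow> conv_f J0 j2 C2 u z \<in> I"
  unfolding conv_f_def using inv_into_into[of "u z" H I] image_conv_H by simp

lemma conv_H_conv_f: "u z \<in> J0 \<Longrightarrow> H (conv_f J0 j2 C2 u z) = u z"
  unfolding conv_f_def using f_inv_into_f[of "u z" H I] image_conv_H by simp

lemma corresponds_via_conv:
  "corresponds_via H (sub_domain D u J0) I (conv_f J0 j2 C2 u) h J0 u j"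
  unfolding corresponds_via_def
  using forward_H_conv image_conv_H forward_j_conv conv_H_conv_f by (simp add: sub_domain_def)

lemma sgn_conv_h:
  assumes "sign_definite_on J0 j" "s \<in> J0" "t \<in> I"
  shows "sgn (h t) = sgn (j s)"
proof -
  have "sgn (h t) = sgn (j (H t))"
    using H.deriv_pos[OF assms(3)] by (simp add: conv_h_eq[OF assms(3)] sgn_divide)
  then show ?thesis using sgn_sign_definite_on[OF assms(1) conv_H_in[OF assms(3)] assms(2)] by simp
qed

lemma system1_conv:
  assumes sys: "system2 D J0 u j"
  shows "system1 D I (conv_f J0 j2 C2 u) h"
proof -
  let ?f = "conv_f J0 j2 C2 u"
  have D: "open D" "smooth_on D u" "J0 = u ` D" "\<And>s. s \<in> J0 \<Longrightarrow> j s \<noteq> 0" "sign_definite_on J0 j"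
    "\<And>z. z \<in> D \<Longrightarrow> eqns2 u z (j (u z))"
    using sys by (auto simp: system2_iff)
  have u: "u z \<in> J0" if "z \<in> D" for z using that D(3) by simp
  have f: "smooth_on D ?f"
    unfolding conv_f_def
    by (rule smooth_on_compose[OF D(1) H.open_image D(2) H.smooth_inv]) (use D(3) image_conv_H in simp)
  have "eqns1 ?f z (h (?f z))" if "z \<in> D" for z
  proof -
    note t = conv_f_in[where u = u, OF u] and Hf = conv_H_conv_f[where u = u, OF u]
    \<comment> \<open>The same transfer as in the forward direction, read from right to left with u
      = H(f).\<close>
    have "eqns1 ?f z (h (?f z)) \<longleftrightarrow> eqns2 u z (h (?f z) * dH (?f z))"
    proof (rule eqns1_iff_eqns2[OF D(1) that f, where H = H and p = dH])
      show "(dH has_real_derivative - h (?f z) * dH (?f z)) (at (?f z))"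
        using deriv_dH[OF t[OF that]] conv_h_dH[OF t[OF that]] by simp
          show "(H has_real_derivative dH (?f w)) (at (?f w))" if "w \<in> D" for w
        using deriv_conv_H[OF t[OF that]] .
    qed (use t that Hf H.deriv_pos[OF t[OF that]] in simp_all)
    then show ?thesis using D(6)[OF that] conv_h_dH[OF t[OF that]] Hf[OF that] by simp
  qed
  moreover have "smooth_on I h"
  proof -
    have "open (- {0::real})" by auto
    then have "smooth_on I (\<lambda>t. inverse (dH t))"
      by (rule smooth_on_compose[OF open_I _ H.smooth_g' smooth_on_inverse])
        (use H.deriv_pos in force)
    moreover have "smooth_on I (\<lambda>t. j (H t))"
      by (rule smooth_on_compose[OF open_I open_J0 H.smooth_g smooth_j]) (simp add: image_conv_H)
    ultimately have "smooth_on I (\<lambda>t. j (H t) * inverse (dH t))"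
      by (intro smooth_on_mult open_I)
    then show ?thesis
      using smooth_on_cong[OF open_I, of h "\<lambda>t. j (H t) * inverse (dH t)"]
      by (simp add: conv_h_eq divide_inverse)
  qed
  moreover have "I = ?f ` D"
  proof -
    have "?f ` D = inv_into I H ` J0" using D(3) by (auto simp: conv_f_def)
    then show ?thesis using H.inv_image image_conv_H by simp
  qed
  moreover have "h t \<noteq> 0" if "t \<in> I" for t
    using that D(4) conv_H_in conv_h_dH[OF that] by force
  moreover have "sign_definite_on I h"
    using D(5) conv_H_in H.deriv_pos
    by (auto simp: sign_definite_on_def conv_h_eq zero_less_divide_iff divide_less_0_iff)
  ultimately show ?thesis
    using D(1) f H.interval_S by (simp add: system1_iff)
qed

end

lemma converse_data_admissible:
  assumes "system2 D J u j" "admissible J j A C1 J0" "conv_j2 A C1 J0 j2"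
  shows "converse_data J0 j A C1 j2"
proof
  show "smooth_on J0 j"
    using assms(1,2) smooth_on_subset by (auto simp: system2_iff admissible_def)
qed (use assms in \<open>auto simp: admissible_def antiderivative_on_def\<close>)

lemma conv_j2_exists:
  assumes "admissible J j A C1 J0"
  shows "\<exists>j2. conv_j2 A C1 J0 j2"
proof -
  have "continuous_on J0 A"
    using assms unfolding admissible_def antiderivative_on_def
    by (meson DERIV_isCont continuous_at_imp_continuous_on subsetD)
  then have "continuous_on J0 (conv_j1 A C1)"
    unfolding conv_j1_def by (intro continuous_intros)
  then have "continuous_on J0 (\<lambda>s. 1 / sqrt (conv_j1 A C1 s))"
    using assms unfolding admissible_def by (intro continuous_intros) force+
  then show ?thesis
    using assms antiderivative_on_exists unfolding conv_j2_def admissible_def by blast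
qed

section \<open>Rigidity of System 2\<close>

text \<open>Used to differentiate an identity: the derivatives of both sides are computed separately
  and compared in a chosen direction.\<close>

lemma has_derivative_cong_unique:
  assumes "open D" "z \<in> D" "\<And>w. w \<in> D \<Longrightarrow> F w = G w"
    and "(F has_derivative F') (at z)" "(G has_derivative G') (at z)"
  shows "F' v = G' v"
proof -
  have "(G has_derivative F') (at z)"
    by (rule has_derivative_transform_within_open[OF assms(4,1,2,3)])
  then show ?thesis using assms(5) has_derivative_unique by blast
qed

text \<open>The derivative of the imaginary part vanishes in the directions 1 and \<i>, which gives
  the imaginary and the real part of g' respectively.\<close>

lemma holomorphic_real_imp_constant:
  assumes "open D" "connected D" "g holomorphic_on D" "\<And>z. z \<in> D \<Longrightarrow> Im (g z) = 0"
  shows "\<exists>c. \<forall>z\<in>D. g z = complex_of_real c"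
proof -
  have "(g has_field_derivative 0) (at z)" if "z \<in> D" for z
  proof -
    have d: "(g has_field_derivative deriv g z) (at z)"
      using holomorphic_derivI[OF assms(3,1) that] .
    then have "((\<lambda>w. Im (g w)) has_derivative (\<lambda>v. Im (deriv g z * v))) (at z)"
      unfolding has_field_derivative_def by (rule has_derivative_Im)
    from has_derivative_cong_unique[OF assms(1) that _ this, of "\<lambda>_. 0" "\<lambda>_. 0"]
    have "Im (deriv g z * v) = 0" for v
      using assms(4) by simp
    from this[of 1] this[of \<i>] have "deriv g z = 0" by (simp add: complex_eq_iff)
    with d show ?thesis by simp
  qed
  then obtain c where c: "\<And>z. z \<in> D \<Longrightarrow> g z = c"
    using has_field_derivative_0_imp_constant_on[OF _ assms(2,1)] unfolding constant_on_def by metis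
  show ?thesis
  proof (cases "D = {}")
    case False
    then have "Im c = 0" using assms(4) c by force
    then have "c = complex_of_real (Re c)" by (simp add: complex_eq_iff)
    then show ?thesis using c by metis
  qed simp
qed

text \<open>
  With \<open>p = u\<^sub>z\<close>, the function \<open>\<phi> = p'/p\<^sup>2\<close> is holomorphic and \<open>j(u) = 2 |p|\<^sup>2 Re \<phi>\<close>. Differentiating
  this identity along \<open>\<i>/p\<close>, a direction tangent to the level lines of \<open>u\<close>, shows that
  \<open>\<phi>\<^sup>2 + \<phi>'/p\<close> is real, hence a constant \<open>c\<close>; differentiating it twice along \<open>1/p\<close> then
  gives the equation for \<open>j\<close>.
\<close>

lemma system2_ode:
  assumes sys: "system2 D J u j" and con: "connected D"
  shows "\<exists>c. \<forall>s\<in>J. (deriv j has_real_derivative c * j s) (at s)"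
proof -
  have D: "open D" "smooth_on D u" "J = u ` D" "smooth_on J j"
    and eq: "\<And>z. z \<in> D \<Longrightarrow> eqns2 u z (j (u z))"
    using sys by (auto simp: system2_iff)
  define p where "p z = Complex (dx u z / 2) (- dy u z / 2)" for z
  have diff: "u differentiable (at z)" "dx u differentiable (at z)" "dy u differentiable (at z)"
    if "z \<in> D" for z
    using that smooth_on_differentiable D(2) smooth_on_dx_dy by blast+
  have dp: "(p has_field_derivative Complex (dx (dx u) z / 2) (- dy (dx u) z / 2)) (at z)"
    if "z \<in> D" for z
  proof -
    have p: "p = (\<lambda>w. (1/2) *\<^sub>R cnj (Complex (dx u w) (dy u w)))"
      by (simp add: p_def fun_eq_iff complex_eq_iff)
    have "((\<lambda>w. (1/2) *\<^sub>R cnj (Complex (dx u w) (dy u w))) has_derivative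
        (\<lambda>v. (1/2) *\<^sub>R cnj (Complex (Re v * dx (dx u) z + Im v * dy (dx u) z)
          (Re v * dx (dy u) z + Im v * dy (dy u) z)))) (at z)"
      by (intro has_derivative_scaleR_right has_derivative_cnj has_derivative_Complex_dx_dy diff that)
    note d = this[folded p]
    \<comment> \<open>These are the Cauchy-Riemann equations for \<open>p\<close>.\<close>
    have "dx (dy u) z = dy (dx u) z" "dy (dy u) z = - dx (dx u) z"
      using eq[OF that] by (auto simp: eqns2_def)
    then show ?thesis
      unfolding has_field_derivative_def
      by (intro has_derivative_eq_rhs[OF d]) (simp add: fun_eq_iff complex_eq_iff field_simps)
  qed
  have holp: "p holomorphic_on D"
    using dp D(1) by (auto simp: holomorphic_on_open)
  have p0: "p z \<noteq> 0" if "z \<in> D" for z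
    using eq[OF that] Complex_eq_0_iff_half(1) by (simp add: p_def eqns2_def)
  define \<phi> where "\<phi> z = deriv p z / (p z)\<^sup>2" for z
  define \<psi> where "\<psi> z = deriv \<phi> z / p z" for z
  have hol\<phi>: "\<phi> holomorphic_on D"
    unfolding \<phi>_def by (intro holomorphic_intros holp D(1)) (use p0 in auto)
  then have hol\<psi>: "\<psi> holomorphic_on D"
    unfolding \<psi>_def by (intro holomorphic_intros holp D(1)) (use p0 in auto)
  define N where "N z = (Re (p z))\<^sup>2 + (Im (p z))\<^sup>2" for z
  have N0: "N z > 0" if "z \<in> D" for z
    using p0[OF that] by (auto simp: N_def complex_eq_iff sum_power2_gt_zero_iff)
  \<comment> \<open>Here and below a derivative along v is expressed through w =
    \<open>p z * v\<close>; since \<open>p\<close> has no zeros, w can then be prescribed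
    freely.\<close>
  have d\<phi>: "(\<phi> has_derivative (\<lambda>v. \<psi> z * (p z * v))) (at z)" if "z \<in> D" for z
    using holomorphic_derivI[OF hol\<phi> D(1) that] p0[OF that]
    by (simp add: \<psi>_def has_field_derivative_def mult.assoc[symmetric] fun_eq_iff)
  \<comment> \<open>N is |p|^2, and p' = \<phi> p^2.\<close>
  have dN: "(N has_derivative (\<lambda>v. 2 * N z * Re (\<phi> z * (p z * v)))) (at z)" if "z \<in> D" for z
  proof -
    have "(p has_derivative (\<lambda>v. p z * (\<phi> z * (p z * v)))) (at z)"
      using holomorphic_derivI[OF holp D(1) that] p0[OF that]
      by (simp add: \<phi>_def has_field_derivative_def power2_eq_square fun_eq_iff)
    then show ?thesis
      unfolding N_def
      by (auto intro!: derivative_eq_intros simp: fun_eq_iff power2_eq_square algebra_simps)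
  qed
  have dcomp: "((\<lambda>w. g (u w)) has_derivative (\<lambda>v. d * (2 * Re (p z * v)))) (at z)"
    if "z \<in> D" "(g has_real_derivative d) (at (u z))" for g d z
  proof -
    have "(g has_derivative (*) d) (at (u z))"
      using that(2) by (simp add: has_field_derivative_def)
    from has_derivative_compose[OF has_derivative_dx_dy[OF diff(1)[OF that(1)]] this]
    show ?thesis by (rule has_derivative_eq_rhs) (simp add: fun_eq_iff p_def algebra_simps)
  qed
  have j1: "j (u z) = 2 * N z * Re (\<phi> z)" if "z \<in> D" for z
  proof -
    have "deriv p z = Complex (dx (dx u) z / 2) (- dy (dx u) z / 2)"
      using dp[OF that] by (rule DERIV_imp_deriv)
    \<comment> \<open>Two factors N = p cnj p clear the denominator p^2 of \<phi>.\<close>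
    moreover have "N z * Re (\<phi> z) * N z = Re (deriv p z * (cnj (p z))\<^sup>2)"
    proof -
      have "\<phi> z * of_real (N z) * of_real (N z) = deriv p z * (cnj (p z))\<^sup>2"
        using p0[OF that] complex_mult_cnj[of "p z", symmetric]
        by (simp add: \<phi>_def N_def power2_eq_square)
      then have "Re (\<phi> z * of_real (N z) * of_real (N z)) = Re (deriv p z * (cnj (p z))\<^sup>2)" by simp
      then show ?thesis by (simp add: mult_ac)
    qed
    ultimately have "N z * Re (\<phi> z) * N z
        = (((dx u z)\<^sup>2 - (dy u z)\<^sup>2) * dx (dx u) z + 2 * dx u z * dy u z * dy (dx u) z) / 8"
      by (simp add: p_def power2_eq_square field_simps)
    moreover have "((dx u z)\<^sup>2 - (dy u z)\<^sup>2) * dx (dx u) z + 2 * dx u z * dy u z * dy (dx u) z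
        = j (u z) * ((dx u z)\<^sup>2 + (dy u z)\<^sup>2)"
    proof -
      have B: "dy (dy u) z = - dx (dx u) z" using eq[OF that] by (simp add: eqns2_def)
      show ?thesis using eq[OF that] unfolding eqns2_def B by (simp add: algebra_simps)
    qed
    moreover have "(dx u z)\<^sup>2 + (dy u z)\<^sup>2 = 4 * N z"
      by (simp add: N_def p_def power_divide)
    ultimately have "(2 * N z * Re (\<phi> z)) * N z = j (u z) * N z" by (simp add: mult_ac)
    then show ?thesis using N0[OF that] by simp
  qed
  have jd: "(j has_real_derivative deriv j (u z)) (at (u z))" if "z \<in> D" for z
    using smooth_on_DERIV[OF D(4)] D(3) that by blast
  have key1: "deriv j (u z) * (2 * Re w)
      = 2 * N z * Re (\<psi> z * w) + 2 * (2 * N z * Re (\<phi> z * w)) * Re (\<phi> z)"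
    if "z \<in> D" for z w
  proof -
    have "((\<lambda>w. 2 * N w * Re (\<phi> w)) has_derivative (\<lambda>v. 2 * N z * Re (\<psi> z * (p z * v))
        + 2 * (2 * N z * Re (\<phi> z * (p z * v))) * Re (\<phi> z))) (at z)"
      by (intro has_derivative_mult has_derivative_mult_right has_derivative_Re d\<phi> dN that)
    from has_derivative_cong_unique[OF D(1) that j1 dcomp[OF that jd[OF that]] this, of "w / p z"]
    show ?thesis using p0[OF that] by simp
  qed
  have "Im ((\<phi> z)\<^sup>2 + \<psi> z) = 0" if "z \<in> D" for z
  proof -
    \<comment> \<open>For w = \<i> the left side of \<open>key1\<close> vanishes; what remains is
      the imaginary part of \<phi>^2 + \<psi>.\<close>
    have "N z * (Im (\<psi> z) + 2 * Im (\<phi> z) * Re (\<phi> z)) = 0"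
      using key1[OF that, of \<i>] by (simp add: algebra_simps)
    then have "Im (\<psi> z) + 2 * Im (\<phi> z) * Re (\<phi> z) = 0" using N0[OF that] by simp
    then show ?thesis by (simp add: power2_eq_square algebra_simps)
  qed
  then obtain c where c: "\<And>z. z \<in> D \<Longrightarrow> (\<phi> z)\<^sup>2 + \<psi> z = complex_of_real c"
    using holomorphic_real_imp_constant[OF D(1) con
        holomorphic_on_add[OF holomorphic_on_power[OF hol\<phi>] hol\<psi>]] by blast
  have \<psi>: "Re (\<psi> z) = c - (Re (\<phi> z))\<^sup>2 + (Im (\<phi> z))\<^sup>2" "Im (\<psi> z) = - 2 * Re (\<phi> z) * Im (\<phi> z)"
    if "z \<in> D" for z
    using c[OF that] by (auto simp: complex_eq_iff power2_eq_square algebra_simps)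
  have j2: "deriv j (u z) = N z * ((Re (\<phi> z))\<^sup>2 + (Im (\<phi> z))\<^sup>2 + c)" if "z \<in> D" for z
    using key1[OF that, of 1] by (simp add: \<psi>[OF that] power2_eq_square algebra_simps)
  have "(deriv j has_real_derivative c * j s) (at s)" if "s \<in> J" for s
  proof -
    obtain z where z: "z \<in> D" "s = u z" using \<open>s \<in> J\<close> D(3) by blast
    have "smooth_on J (deriv j)"
      using smooth_on_real_iff[OF system2_open[OF sys] smooth_on_DERIV[OF D(4)]] D(4) by blast
    then have dd: "(deriv j has_real_derivative deriv (deriv j) (u z)) (at (u z))"
      using smooth_on_DERIV \<open>s \<in> J\<close> z(2) by blast
    have "((\<lambda>z. N z * ((Re (\<phi> z))\<^sup>2 + (Im (\<phi> z))\<^sup>2 + c)) has_derivative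
        (\<lambda>v. N z * (2 * Re (\<phi> z) * Re (\<psi> z * (p z * v)) + 2 * Im (\<phi> z) * Im (\<psi> z * (p z * v)))
          + 2 * N z * Re (\<phi> z * (p z * v)) * ((Re (\<phi> z))\<^sup>2 + (Im (\<phi> z))\<^sup>2 + c))) (at z)"
      by (rule has_derivative_eq_rhs,
          (rule has_derivative_mult has_derivative_add has_derivative_power has_derivative_const
            has_derivative_Re has_derivative_Im d\<phi> dN z(1))+)
        (simp add: fun_eq_iff algebra_simps)
    from has_derivative_cong_unique[OF D(1) z(1) j2 dcomp[OF z(1) dd] this, of "1 / p z"]
    have "deriv (deriv j) (u z) * 2 = N z * (2 * Re (\<phi> z) * Re (\<psi> z) + 2 * Im (\<phi> z) * Im (\<psi> z))
          + 2 * N z * Re (\<phi> z) * ((Re (\<phi> z))\<^sup>2 + (Im (\<phi> z))\<^sup>2 + c)"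
      using p0[OF z(1)] by simp
    \<comment> \<open>From \<psi> = c - \<phi>^2 one gets Re \<phi> Re \<psi> + Im \<phi> Im \<psi>
      = Re \<phi> (c - |\<phi>|^2). The terms in |\<phi>|^2 cancel, leaving 2 c N Re \<phi>.\<close>
    then have "deriv (deriv j) (u z) = c * j (u z)"
      by (simp add: j1[OF z(1)] \<psi>[OF z(1)] power2_eq_square algebra_simps)
    with dd z(2) show ?thesis by simp
  qed
  then show ?thesis by blast
qed

section \<open>Bounds on j and the choice of \<open>C1\<close>\<close>

lemma linear_ode_bounded:
  fixes j dj :: "real \<Rightarrow> real"
  assumes "\<And>s. \<bar>s - s0\<bar> < r \<Longrightarrow> (j has_real_derivative dj s) (at s)"
    and "\<And>s. \<bar>s - s0\<bar> < r \<Longrightarrow> (dj has_real_derivative c * j s) (at s)"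
  shows "\<exists>M. \<forall>s. \<bar>s - s0\<bar> < r \<longrightarrow> \<bar>j s\<bar> \<le> M"
proof -
  \<comment> \<open>A Gronwall estimate: |E'| is at most |1 + c| E, so E grows at most exponentially
    away from \<open>s0\<close>, with a bound depending on \<open>r\<close> but not on the distance
    to the end points.\<close>
  define E where "E s = (j s)\<^sup>2 + (dj s)\<^sup>2" for s
  define L where "L = 1 + \<bar>c\<bar>"
  have dE: "(E has_real_derivative 2 * (1 + c) * (j s * dj s)) (at s)" if "\<bar>s - s0\<bar> < r" for s
    unfolding E_def using assms(1,2)[OF that]
    by (auto intro!: derivative_eq_intros simp: algebra_simps)
  have E': "\<bar>2 * (1 + c) * (j s * dj s)\<bar> \<le> L * E s" for s
  proof -
    have "2 * \<bar>j s * dj s\<bar> \<le> E s"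
      using sum_squares_bound[of "\<bar>j s\<bar>" "\<bar>dj s\<bar>"] by (simp add: E_def abs_mult)
    moreover have "\<bar>1 + c\<bar> \<le> L" by (simp add: L_def)
    ultimately have "\<bar>1 + c\<bar> * (2 * \<bar>j s * dj s\<bar>) \<le> L * E s"
      by (intro mult_mono) (auto simp: L_def)
    moreover have "\<bar>2 * (1 + c) * (j s * dj s)\<bar> = \<bar>1 + c\<bar> * (2 * \<bar>j s * dj s\<bar>)"
      by (simp only: abs_mult abs_numeral mult_ac)
    ultimately show ?thesis by simp
  qed
  have "E s \<le> E s0 * exp (L * r)" if s: "\<bar>s - s0\<bar> < r" for s
  proof -
    have "E s \<le> E s0 * exp (L * \<bar>s - s0\<bar>)"
    proof (cases "s0 \<le> s")
      case True
      \<comment> \<open>The integrating factor turns the differential inequality into monotonicity;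
        to the left of \<open>s0\<close> the opposite sign is used.\<close>
      have "E s * exp (- L * s) \<le> E s0 * exp (- L * s0)"
      proof (rule DERIV_nonpos_imp_nonincreasing[OF True, where f = "\<lambda>s. E s * exp (- L * s)"])
        fix x assume "s0 \<le> x" "x \<le> s"
        then have x: "\<bar>x - s0\<bar> < r" using s by auto
        have "((\<lambda>s. E s * exp (- L * s)) has_real_derivative
            (2 * (1 + c) * (j x * dj x) - L * E x) * exp (- L * x)) (at x)"
          by (rule derivative_eq_intros dE[OF x] refl)+ (simp add: algebra_simps)
        moreover have "2 * (1 + c) * (j x * dj x) - L * E x \<le> 0" using E'[of x] by linarith
        ultimately show "\<exists>y. ((\<lambda>s. E s * exp (- L * s)) has_real_derivative y) (at x) \<and> y \<le> 0"
          using mult_nonpos_nonneg exp_ge_zero by blast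
      qed
      then show ?thesis using True by (simp add: exp_minus exp_diff field_simps)
    next
      case False
      have "E s * exp (L * s) \<le> E s0 * exp (L * s0)"
      proof (rule DERIV_nonneg_imp_nondecreasing[where f = "\<lambda>s. E s * exp (L * s)"])
        fix x assume "s \<le> x" "x \<le> s0"
        then have x: "\<bar>x - s0\<bar> < r" using s by auto
        have "((\<lambda>s. E s * exp (L * s)) has_real_derivative
            (2 * (1 + c) * (j x * dj x) + L * E x) * exp (L * x)) (at x)"
          by (rule derivative_eq_intros dE[OF x] refl)+ (simp add: algebra_simps)
        moreover have "2 * (1 + c) * (j x * dj x) + L * E x \<ge> 0" using E'[of x] by linarith
        ultimately show "\<exists>y. ((\<lambda>s. E s * exp (L * s)) has_real_derivative y) (at x) \<and> 0 \<le> y"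
          using mult_nonneg_nonneg exp_ge_zero by blast
      qed (use False in simp)
      then show ?thesis using False by (simp add: exp_minus exp_diff field_simps)
    qed
    also have "\<dots> \<le> E s0 * exp (L * r)"
      by (intro mult_left_mono) (use s in \<open>auto simp: E_def L_def intro: mult_left_mono\<close>)
    finally show ?thesis .
  qed
  moreover have "\<bar>j s\<bar> \<le> 1 + E s" for s
  proof -
    have "2 * \<bar>j s\<bar> \<le> 1 + (j s)\<^sup>2" using sum_squares_bound[of "\<bar>j s\<bar>" 1] by simp
    moreover have "(dj s)\<^sup>2 \<ge> 0" "(j s)\<^sup>2 \<ge> 0" by auto
    ultimately show ?thesis unfolding E_def by linarith
  qed
  ultimately have "\<bar>j s\<bar> \<le> 1 + E s0 * exp (L * r)" if "\<bar>s - s0\<bar> < r" for s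
    using that by (meson add_left_mono order_trans)
  then show ?thesis by blast
qed

text \<open>A bound for j on the whole interval limits the variation of A by the mean value theorem,
  so A is bounded above there and a large \<open>C1\<close> makes j1 positive.\<close>

lemma admissible_exists:
  assumes sys: "system2 D J u j" and con: "connected D" and A: "antiderivative_on J j A"
    and r: "r > 0" and sub: "{s0 - r<..<s0 + r} \<subseteq> J"
  shows "\<exists>C1. admissible J j A C1 {s0 - r<..<s0 + r}"
proof -
  have in_J: "s \<in> J" if "\<bar>s - s0\<bar> < r" for s
    using that sub by (auto simp: abs_less_iff)
  obtain c where c: "\<And>s. s \<in> J \<Longrightarrow> (deriv j has_real_derivative c * j s) (at s)"
    using system2_ode[OF sys con] by blast
  have "(j has_real_derivative deriv j s) (at s)" if "s \<in> J" for s
    using sys that smooth_on_DERIV by (auto simp: system2_iff)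
  then obtain M where M: "\<And>s. \<bar>s - s0\<bar> < r \<Longrightarrow> \<bar>j s\<bar> \<le> M"
    using linear_ode_bounded[of s0 r j "deriv j" c] c in_J by blast
  \<comment> \<open>Since A exceeds \<open>A s0\<close> by at most \<open>M * r\<close>, this
    constant gives j1 at least 1.\<close>
  have "conv_j1 A (2 * (A s0 + M * r) + 1) s > 0" if s: "s \<in> {s0 - r<..<s0 + r}" for s
  proof -
    have "norm (A s - A s0) \<le> M * norm (s - s0)"
    proof (rule field_differentiable_bound[where S = "{s0 - r<..<s0 + r}"])
      show "(A has_real_derivative j x) (at x within {s0 - r<..<s0 + r})"
        if "x \<in> {s0 - r<..<s0 + r}" for x
        using that A sub unfolding antiderivative_on_def
        by (meson has_field_derivative_at_within subsetD)
      show "norm (j x) \<le> M" if "x \<in> {s0 - r<..<s0 + r}" for x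
        using M[of x] that by (auto simp: abs_less_iff)
    qed (use s r in auto)
    also have "\<dots> \<le> M * r"
      using s M[of s0] r by (intro mult_left_mono) (auto simp: abs_le_iff)
    finally show ?thesis by (simp add: conv_j1_def abs_le_iff)
  qed
  then have "admissible J j A (2 * (A s0 + M * r) + 1) {s0 - r<..<s0 + r}"
    using A r sub by (auto simp: admissible_def is_interval_1)
  then show ?thesis by blast
qed

section \<open>Uniqueness of the constants\<close>

lemma DERIV_zero_constant:
  assumes "convex S" "\<And>t. t \<in> S \<Longrightarrow> (f has_real_derivative 0) (at t)"
  shows "\<exists>c. \<forall>t\<in>S. f t = c"
  by (rule has_field_derivative_zero_constant[OF assms(1) has_field_derivative_at_within[OF assms(2)]])
    blast

text \<open>The form of the quantifiers reflects the two integrations: a constant added to A is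
  compensated by \<open>C1\<close>, and one added to \<open>j2\<close> by \<open>C2\<close>. So
  \<open>C1\<close> is unique for the given A, while \<open>C2\<close> is unique for each
  antiderivative \<open>j2\<close>.\<close>

lemma corresponds_via_unique:
  assumes sys2: "system2 \<Omega> J u j" and A: "antiderivative_on J j A"
    and J0: "open J0" "is_interval J0" "J0 \<noteq> {}" "J0 \<subseteq> J"
    and sys1: "system1 D I g k" and via: "corresponds_via G D I g k J0 u j"
  shows "\<exists>!C1. admissible J j A C1 J0 \<and>
            (\<forall>j2. conv_j2 A C1 J0 j2 \<longrightarrow>
               (\<exists>!C2. I = conv_I J0 j2 C2 \<and>
                  (\<forall>z\<in>D. g z = conv_f J0 j2 C2 u z) \<and>
                  (\<forall>t\<in>I. k t = conv_h J0 j2 C2 t) \<and>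
                  (\<forall>t\<in>I. G t = conv_H J0 j2 C2 t)))"
proof -
  obtain H1 where H1: "antiderivative_on I k H1" "antiderivative_on I (\<lambda>t. exp (- H1 t)) G"
    using via by (auto simp: corresponds_via_def forward_H_def)
  have GI: "J0 = G ` I" and uG: "\<And>z. z \<in> D \<Longrightarrow> u z = G (g z)"
    and jG: "\<And>s. s \<in> J0 \<Longrightarrow> j s = forward_j I k G s"
    using via by (auto simp: corresponds_via_def)
  have I: "open I" "is_interval I" "smooth_on I k" "I = g ` D"
    using sys1 system1_open by (auto simp: system1_iff)
  define dG where "dG t = exp (- H1 t)" for t
  interpret G: increasing_diffeo I G dG
    unfolding dG_def by (rule forward_increasing_diffeo[OF I(1,2,3) H1])
  obtain t0 where t0: "t0 \<in> I" using J0(3) GI by blast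
  have G_in: "G t \<in> J0" if "t \<in> I" for t using that GI by blast
  have jG': "j (G t) = k t * dG t" if "t \<in> I" for t
    using jG[OF G_in[OF that]] G.forward_j_image[OF that] by simp
  have ddG: "(dG has_real_derivative - k t * dG t) (at t)" if "t \<in> I" for t
    using forward_deriv2[OF H1(1) that] unfolding dG_def .
  have dA: "(A has_real_derivative j s) (at s)" if "s \<in> J0" for s
    using A J0(4) that by (auto simp: antiderivative_on_def)
  have convI: "convex I" using I(2) is_interval_convex_1 by blast
  \<comment> \<open>Conservation of energy: G'' = - k G' and j(G) = k G', so the two contributions
    cancel. The conserved value is \<open>C1\<close>.\<close>
  have "((\<lambda>t. (dG t)\<^sup>2 + 2 * A (G t)) has_real_derivative 0) (at t)" if "t \<in> I" for t
    using DERIV_add[OF DERIV_power[OF ddG[OF that], of 2]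
        DERIV_cmult[OF DERIV_chain2[OF dA[OF G_in[OF that]] G.deriv_g[OF that]], of 2]]
    by (simp add: jG'[OF that] power2_eq_square)
  from DERIV_zero_constant[OF convI this]
  obtain c where "\<And>t. t \<in> I \<Longrightarrow> (dG t)\<^sup>2 + 2 * A (G t) = c" by blast
  then have c: "conv_j1 A c (G t) = (dG t)\<^sup>2" if "t \<in> I" for t
    using that by (force simp: conv_j1_def)
  have sqrt_c: "sqrt (conv_j1 A c (G t)) = dG t" if "t \<in> I" for t
    using c[OF that] G.deriv_pos[OF that] by simp
  have adm: "admissible J j A c J0"
    unfolding admissible_def using A J0 GI c G.deriv_pos by force
  have data: "converse_data J0 j A C j2" if "admissible J j A C J0" "conv_j2 A C J0 j2" for C j2
    using converse_data_admissible[OF sys2 that] .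
  show ?thesis
  proof (rule ex1I[of _ c], intro conjI adm allI impI)
    fix j2 assume j2: "conv_j2 A c J0 j2"
    \<comment> \<open>The quadrature inverts G up to a translation, and that translation is
      \<open>C2\<close>.\<close>
    have "((\<lambda>t. j2 (G t) - t) has_real_derivative 0) (at t)" if "t \<in> I" for t
    proof -
      have "(j2 has_real_derivative 1 / dG t) (at (G t))"
        using j2 G_in[OF that] sqrt_c[OF that] unfolding conv_j2_def antiderivative_on_def by metis
      from DERIV_chain2[OF this G.deriv_g[OF that]] G.deriv_pos[OF that]
      have "((\<lambda>t. j2 (G t)) has_real_derivative 1) (at t)" by simp
      from DERIV_diff[OF this DERIV_ident] show ?thesis by simp
    qed
    from DERIV_zero_constant[OF convI this]
    obtain d where "\<And>t. t \<in> I \<Longrightarrow> j2 (G t) - t = d" by blast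
    then have d: "j2 (G t) - d = t" if "t \<in> I" for t using that by force
    interpret cd: converse_data J0 j A c j2 d using data[OF adm j2] .
    have Ieq: "I = conv_I J0 j2 d" unfolding conv_I_def GI image_image using d by simp
    have Heq: "G t = conv_H J0 j2 d t" if "t \<in> I" for t
      using cd.conv_H_j2[OF G_in[OF that]] d[OF that] by simp
    show "\<exists>!C2. I = conv_I J0 j2 C2 \<and> (\<forall>z\<in>D. g z = conv_f J0 j2 C2 u z) \<and>
        (\<forall>t\<in>I. k t = conv_h J0 j2 C2 t) \<and> (\<forall>t\<in>I. G t = conv_H J0 j2 C2 t)"
    proof (rule ex1I[of _ d], intro conjI ballI)
      show "g z = conv_f J0 j2 d u z" if "z \<in> D" for z
      proof -
        have "g z \<in> I" using that I(4) by blast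
        then show ?thesis
          using inv_into_f_f[OF cd.H.inj, of "g z"] Heq uG[OF that] Ieq by (simp add: conv_f_def)
      qed
      show "k t = conv_h J0 j2 d t" if "t \<in> I" for t
      proof -
        have "conv_h J0 j2 d t * dG t = k t * dG t"
          using cd.conv_h_dH[of t] that Ieq Heq[OF that] sqrt_c[OF that] jG'[OF that] by simp
        then show ?thesis using G.deriv_pos[OF that] by simp
      qed
    next
      fix C2 assume C2: "I = conv_I J0 j2 C2 \<and> (\<forall>z\<in>D. g z = conv_f J0 j2 C2 u z) \<and>
        (\<forall>t\<in>I. k t = conv_h J0 j2 C2 t) \<and> (\<forall>t\<in>I. G t = conv_H J0 j2 C2 t)"
      \<comment> \<open>One point suffices: t0 = j2 (G t0) - C2 and t0 = j2 (G t0) - d.\<close>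
      then obtain s where s: "s \<in> J0" "t0 = j2 s - C2" using t0 by (auto simp: conv_I_def)
      then have "G t0 = s"
        using C2 t0 converse_data.conv_H_j2[OF data[OF adm j2] s(1)] by simp
      then show "C2 = d" using d[OF t0] s(2) by simp
    qed (fact Ieq Heq)+
  next
    fix C assume C: "admissible J j A C J0 \<and>
            (\<forall>j2. conv_j2 A C J0 j2 \<longrightarrow>
               (\<exists>!C2. I = conv_I J0 j2 C2 \<and>
                  (\<forall>z\<in>D. g z = conv_f J0 j2 C2 u z) \<and>
                  (\<forall>t\<in>I. k t = conv_h J0 j2 C2 t) \<and>
                  (\<forall>t\<in>I. G t = conv_H J0 j2 C2 t)))"
    then have "admissible J j A C J0" by blast
    \<comment> \<open>An actual \<open>j2\<close> has to exist, since the condition on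
      \<open>C\<close> is quantified over all of them and could otherwise hold vacuously.\<close>
    from conv_j2_exists[OF this] obtain j2 where j2: "conv_j2 A C J0 j2" by blast
    with C obtain C2 where C2: "I = conv_I J0 j2 C2" "\<And>t. t \<in> I \<Longrightarrow> G t = conv_H J0 j2 C2 t"
      by (metis (no_types, lifting))
    interpret cd: converse_data J0 j A C j2 C2 using data j2 C by blast
    \<comment> \<open>Comparing the two expressions for G' at \<open>t0\<close> determines j1 at one
      point, and hence its additive constant.\<close>
    have "(G has_real_derivative sqrt (conv_j1 A C (conv_H J0 j2 C2 t0))) (at t0)"
      by (rule has_field_derivative_transform_within_open[OF cd.deriv_conv_H I(1) t0])
        (use t0 C2 in auto)
    then have "sqrt (conv_j1 A C (G t0)) = dG t0"
      using DERIV_unique[OF G.deriv_g[OF t0]] C2(2)[OF t0] by simp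
    then have "conv_j1 A C (G t0) = conv_j1 A c (G t0)"
      using sqrt_c[OF t0] real_sqrt_eq_iff by metis
    then show "C = c" by (simp add: conv_j1_def)
  qed
qed

section \<open>Assembly of the equivalence, the choice of constants and uniqueness\<close>

theorem theorem7p5:
  fixes \<Omega> :: "complex set"
  assumes "open \<Omega>" and "connected \<Omega>"
  shows
    "(\<forall>I f h. system1 \<Omega> I f h \<longrightarrow>
       (\<exists>H. forward_H I h H) \<and>
       (\<forall>H. forward_H I h H \<longrightarrow>
          (\<forall>t\<in>I. deriv H t > 0) \<and> diffeo I (H ` I) H \<and>
          system2 \<Omega> (H ` I) (H \<circ> f) (forward_j I h H) \<and>
          (\<forall>t\<in>I. \<forall>s\<in>H ` I. sgn (forward_j I h H s) = sgn (h t)))) \<and>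
     (\<forall>J u j. system2 \<Omega> J u j \<longrightarrow>
       (\<exists>A. antiderivative_on J j A) \<and>
       (\<forall>A C1 J0. admissible J j A C1 J0 \<longrightarrow>
          (\<exists>j2. conv_j2 A C1 J0 j2) \<and>
          (\<forall>j2 C2. conv_j2 A C1 J0 j2 \<longrightarrow>
             diffeo J0 (j2 ` J0) j2 \<and>
             diffeo (j2 ` J0) J0 (conv_j3 J0 j2) \<and>
             diffeo (conv_I J0 j2 C2) J0 (conv_H J0 j2 C2) \<and>
             system1 (sub_domain \<Omega> u J0) (conv_I J0 j2 C2)
               (conv_f J0 j2 C2 u) (conv_h J0 j2 C2) \<and>
             (\<forall>s\<in>J0. \<forall>t\<in>conv_I J0 j2 C2. sgn (conv_h J0 j2 C2 t) = sgn (j s))))) \<and>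
     (\<forall>J u j A C1 C2 J0 j2.
       system2 \<Omega> J u j \<and> admissible J j A C1 J0 \<and> conv_j2 A C1 J0 j2 \<longrightarrow>
         system2 (sub_domain \<Omega> u J0) J0 u j \<and>
         corresponds_via (conv_H J0 j2 C2) (sub_domain \<Omega> u J0)
           (conv_I J0 j2 C2) (conv_f J0 j2 C2 u) (conv_h J0 j2 C2) J0 u j) \<and>
     (\<forall>J u j A s0 r.
       system2 \<Omega> J u j \<and> antiderivative_on J j A \<and>
       s0 \<in> J \<and> r > 0 \<and> {s0 - r<..<s0 + r} \<subseteq> J \<longrightarrow>
         (\<exists>C1 C2 j2. admissible J j A C1 {s0 - r<..<s0 + r} \<and>
            conv_j2 A C1 {s0 - r<..<s0 + r} j2 \<and>
            system1 (sub_domain \<Omega> u {s0 - r<..<s0 + r}) (conv_I {s0 - r<..<s0 + r} j2 C2)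
              (conv_f {s0 - r<..<s0 + r} j2 C2 u) (conv_h {s0 - r<..<s0 + r} j2 C2) \<and>
            system2 (sub_domain \<Omega> u {s0 - r<..<s0 + r}) {s0 - r<..<s0 + r} u j \<and>
            corresponds_via (conv_H {s0 - r<..<s0 + r} j2 C2)
              (sub_domain \<Omega> u {s0 - r<..<s0 + r})
              (conv_I {s0 - r<..<s0 + r} j2 C2) (conv_f {s0 - r<..<s0 + r} j2 C2 u)
              (conv_h {s0 - r<..<s0 + r} j2 C2) {s0 - r<..<s0 + r} u j)) \<and>
     (\<forall>J u j A J0 I g k G.
       system2 \<Omega> J u j \<and> antiderivative_on J j A \<and>
       open J0 \<and> is_interval J0 \<and> J0 \<noteq> {} \<and> J0 \<subseteq> J \<and>
       system1 (sub_domain \<Omega> u J0) I g k \<and>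
       corresponds_via G (sub_domain \<Omega> u J0) I g k J0 u j \<longrightarrow>
         (\<exists>!C1. admissible J j A C1 J0 \<and>
            (\<forall>j2. conv_j2 A C1 J0 j2 \<longrightarrow>
               (\<exists>!C2. I = conv_I J0 j2 C2 \<and>
                  (\<forall>z\<in>sub_domain \<Omega> u J0. g z = conv_f J0 j2 C2 u z) \<and>
                  (\<forall>t\<in>I. k t = conv_h J0 j2 C2 t) \<and>
                  (\<forall>t\<in>I. G t = conv_H J0 j2 C2 t)))))"
proof (intro conjI allI impI; (elim conjE)?)
  fix I f h assume sys: "system1 \<Omega> I f h"
  then show "\<exists>H. forward_H I h H"
    using forward_H_exists[OF system1_open[OF sys]] unfolding system1_iff by blast
  fix H assume "forward_H I h H"
  then show "\<forall>t\<in>I. deriv H t > 0" "diffeo I (H ` I) H"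
    "system2 \<Omega> (H ` I) (H \<circ> f) (forward_j I h H)"
    "\<forall>t\<in>I. \<forall>s\<in>H ` I. sgn (forward_j I h H s) = sgn (h t)"
    using system1_imp_system2[OF sys] by blast+
next
  fix J u j assume sys: "system2 \<Omega> J u j"
  then show "\<exists>A. antiderivative_on J j A"
    using antiderivative_on_exists[OF system2_open[OF sys]] smooth_on_continuous_on
    unfolding system2_iff by blast
  fix A C1 J0 assume adm: "admissible J j A C1 J0"
  then show "\<exists>j2. conv_j2 A C1 J0 j2" by (rule conv_j2_exists)
  fix j2 C2 assume "conv_j2 A C1 J0 j2"
  then interpret converse_data J0 j A C1 j2 C2
    by (rule converse_data_admissible[OF sys adm])
  have sys0: "system2 (sub_domain \<Omega> u J0) J0 u j"
    using system2_restrict[OF sys] adm by (simp add: admissible_def)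
  show "diffeo J0 (j2 ` J0) j2" by (rule j2.diffeo_image)
  show "diffeo (j2 ` J0) J0 (conv_j3 J0 j2)"
    using increasing_diffeo.diffeo_image[OF j2.inverse_increasing_diffeo]
    by (simp add: conv_j3_def j2.inv_image)
  show "diffeo I J0 H" using H.diffeo_image by (simp add: image_conv_H)
  show "system1 (sub_domain \<Omega> u J0) I (conv_f J0 j2 C2 u) h" by (rule system1_conv[OF sys0])
  show "\<forall>s\<in>J0. \<forall>t\<in>I. sgn (h t) = sgn (j s)"
    using sgn_conv_h sys0 by (simp add: system2_iff)
next
  fix J u j A C1 C2 J0 j2
  assume sys: "system2 \<Omega> J u j" and adm: "admissible J j A C1 J0" and "conv_j2 A C1 J0 j2"
  then interpret converse_data J0 j A C1 j2 C2 by (intro converse_data_admissible)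
  show "system2 (sub_domain \<Omega> u J0) J0 u j"
    using system2_restrict[OF sys] adm by (simp add: admissible_def)
  show "corresponds_via H (sub_domain \<Omega> u J0) I (conv_f J0 j2 C2 u) h J0 u j"
    by (rule corresponds_via_conv)
next
  fix J u j A s0 and r :: real
  let ?J0 = "{s0 - r<..<s0 + r}"
  assume sys: "system2 \<Omega> J u j" and A: "antiderivative_on J j A" "r > 0" "?J0 \<subseteq> J"
  obtain C1 where adm: "admissible J j A C1 ?J0"
    using admissible_exists[OF sys assms(2) A] by blast
  obtain j2 where j2: "conv_j2 A C1 ?J0 j2" using conv_j2_exists[OF adm] by blast
  \<comment> \<open>Any \<open>C2\<close> would do, as it only translates f and the domain of h; 0
    is taken.\<close>
  interpret converse_data ?J0 j A C1 j2 0 by (rule converse_data_admissible[OF sys adm j2])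
  have sys0: "system2 (sub_domain \<Omega> u ?J0) ?J0 u j"
    using system2_restrict[OF sys] adm by (simp add: admissible_def)
  show "\<exists>C1 C2 j2. admissible J j A C1 ?J0 \<and> conv_j2 A C1 ?J0 j2 \<and>
      system1 (sub_domain \<Omega> u ?J0) (conv_I ?J0 j2 C2) (conv_f ?J0 j2 C2 u) (conv_h ?J0 j2 C2) \<and>
      system2 (sub_domain \<Omega> u ?J0) ?J0 u j \<and>
      corresponds_via (conv_H ?J0 j2 C2) (sub_domain \<Omega> u ?J0) (conv_I ?J0 j2 C2)
        (conv_f ?J0 j2 C2 u) (conv_h ?J0 j2 C2) ?J0 u j"
    using adm j2 system1_conv[OF sys0] sys0 corresponds_via_conv by blast
next
  fix J u j A J0 I g k G
  assume "system2 \<Omega> J u j" "antiderivative_on J j A" "open J0" "is_interval J0" "J0 \<noteq> {}" "J0 \<subseteq> J"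
    "system1 (sub_domain \<Omega> u J0) I g k" "corresponds_via G (sub_domain \<Omega> u J0) I g k J0 u j"
  then show "\<exists>!C1. admissible J j A C1 J0 \<and>
      (\<forall>j2. conv_j2 A C1 J0 j2 \<longrightarrow>
         (\<exists>!C2. I = conv_I J0 j2 C2 \<and>
            (\<forall>z\<in>sub_domain \<Omega> u J0. g z = conv_f J0 j2 C2 u z) \<and>
            (\<forall>t\<in>I. k t = conv_h J0 j2 C2 t) \<and> (\<forall>t\<in>I. G t = conv_H J0 j2 C2 t)))"
    by (rule corresponds_via_unique)
qed

end
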